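(* Let $t\ge 2$ be a fixed integer. Calculating the first $N$ terms of the sequence $g_t(n)$ (i.e. all values $g_t(n)$ with $0\le n<N$) can be done with $$\mathbf{D} + \bigl(\log_t N+O(1)\bigr)\,\mathbf{M} + 2\bigl(\log_t N+O(1)\bigr)\,\mathbf{A} + O(\log N)\,\mathbf{S} + O(\log N)\,\mathbf{O}$$ power series operations, with $$N(\log N)^2\,2^{O(\log^* N)}$$ operations in the ring of integers, and with $$N^2(\log N)^4\,2^{O(\log^* N)}$$ bit operations.
   Context: Fix an integer $t\ge 2$. For $r\ge 0$ let $$f_t(r) = \Bigl|\Bigl\{(x_1,\dots,x_r)\in\mathbb{Z}^r : 0\le x_1\le\cdots\le x_r,\ \sum_{i=1}^r \frac{1}{t^{x_i}}=1\Bigr\}\Bigr|,$$ and for $n\ge 0$ let $g_t(n)=f_t(1+n(t-1))$. Asymptotic notation refers to $N\to\infty$ with $t$ fixed. The iterated logarithm $\log^*$ is defined recursively by $\log^* x = 1+\log^*(\log x)$ if $x>1$ and $\log^* x=0$ otherwise. A power series $H$ has precision $N$ if it is written as $H(q)=\sum_{n=0}^{N-1}h_nq^n+O(q^N)$ with explicit coefficients $h_n$. All power series here have integer coefficients and precision $N$. The count of power series operations is a formal sum of the following symbols: - $\mathbf{A}$: an addition (or subtraction) of two power series of precision $N$; - $\mathbf{M}$: a multiplication of two power series of precision $N$; - $\mathbf{D}$: a division of two power series of precision $N$; - $\mathbf{S}$: another power series operation of precision $N$ (for example memory allocation, writing initial values, swapping, or shifting by a power of $q$); - $\mathbf{O}$: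 another operation, on numbers with less than $\log_2 N$ bits (for example additions of indices). The coefficients of the power series occurring in $\mathbf{A}$, $\mathbf{M}$, $\mathbf{D}$ are integers that can be written with at most $\lfloor\log_2 g_t(N)\rfloor+1$ bits. Operations in the ring of integers count arithmetic operations (additions, multiplications) on integers at unit cost irrespective of their size; bit operations take into account the bit size of the integers. Costs of the underlying operations, for power series of precision $N$ with integer coefficients of bit size $m=O(N)$: an addition takes $O(N)$ ring operations and $O(Nm)$ bit operations; a multiplication takes $N\log N\,2^{O(\log^* N)}$ ring operations and $N\log N\,2^{O(\log^* N)}\cdot m\log m$ bit operations; a division takes $N\log N\,2^{O(\log^* N)}$ ring operations and $N^2m(\log N)^2\,2^{O(\log^* N)}$ bit operations.
   Formalization: The costs of S and O, left unspecified, are taken as those of an addition for S and as O(1) ring and O((log N)^2) bit operations for O; "less than log_2 N bits" is read as at most floor(log_2 N)+1 bits for large N, since N itself has that many. *)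

theory Defs
  imports
    Complex_Main
    "HOL-Library.Landau_Symbols"
    "HOL-Library.Log_Nat"
    "HOL-Computational_Algebra.Formal_Power_Series"
begin

definition f_t :: "nat \<Rightarrow> nat \<Rightarrow> nat" where
  "f_t t r = card {xs :: int list. length xs = r \<and> (\<forall>x\<in>set xs. 0 \<le> x) \<and> sorted xs \<and>
                   (\<Sum>x\<leftarrow>xs. 1 / real t powi x) = 1}"

definition g_t :: "nat \<Rightarrow> nat \<Rightarrow> nat" where
  "g_t t n = f_t t (1 + n * (t - 1))"

function log_star :: "real \<Rightarrow> nat" where
  "log_star x = (if x > 1 then 1 + log_star (ln x) else 0)"
  by auto
termination
proof (relation "measure (\<lambda>x. nat \<lfloor>x\<rfloor>)")
  fix x :: real
  assume "x > 1"
  then have "ln x \<le> x - 1" by (simp add: ln_le_minus_one)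
  then have "\<lfloor>ln x\<rfloor> \<le> \<lfloor>x\<rfloor> - 1" by linarith
  moreover from \<open>x > 1\<close> have "\<lfloor>x\<rfloor> \<ge> 1" by linarith
  ultimately show "(ln x, x) \<in> measure (\<lambda>x. nat \<lfloor>x\<rfloor>)" by simp
qed simp

declare log_star.simps [simp del]

text \<open>
  A power series of precision \<open>N\<close> is an integer power series cut off at \<open>N\<close>.
  Algorithms are programs of a small imperative language. Its state consists of registers holding
  power series of precision \<open>N\<close> and of registers holding numbers (indices). Control flow can only
  depend on the index registers. An execution yields the list of the operations performed,
  together with their operands.
\<close>

datatype series_op = Add | Sub | Mul | Div

text \<open>
  A division requires that the constant coefficient of the divisor is a unit of the integers,
  i.e. 1 or -1, and hence its own inverse.
\<close>

fun series_defined :: "series_op \<Rightarrow> int fps \<Rightarrow> bool" where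
  "series_defined Div b \<longleftrightarrow> is_unit (fps_nth b 0)"
| "series_defined _ b \<longleftrightarrow> True"

fun series_result :: "nat \<Rightarrow> series_op \<Rightarrow> int fps \<Rightarrow> int fps \<Rightarrow> int fps" where
  "series_result N Add a b = fps_cutoff N (a + b)"
| "series_result N Sub a b = fps_cutoff N (a - b)"
| "series_result N Mul a b = fps_cutoff N (a * b)"
| "series_result N Div a b = fps_cutoff N (a * fps_right_inverse b (fps_nth b 0))"

datatype index_op = IAdd | ISub | IMul | IDiv

fun index_result :: "index_op \<Rightarrow> nat \<Rightarrow> nat \<Rightarrow> nat" where
  "index_result IAdd i j = i + j"
| "index_result ISub i j = i - j"
| "index_result IMul i j = i * j"
| "index_result IDiv i j = i div j"

text \<open>
  Series operations of the last three kinds below carry, respectively, the operands of an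
  addition, subtraction, multiplication or division, the power series written by another series
  operation, and all the numbers (operands and result) handled by an index operation.
\<close>

datatype operation =
    Arith series_op "int fps" "int fps"
  | Other_Series "int fps"
  | Index "nat list"

datatype symbol = A_op | M_op | D_op | S_op | O_op

fun symbol_of :: "operation \<Rightarrow> symbol" where
  "symbol_of (Arith Add _ _) = A_op"
| "symbol_of (Arith Sub _ _) = A_op"
| "symbol_of (Arith Mul _ _) = M_op"
| "symbol_of (Arith Div _ _) = D_op"
| "symbol_of (Other_Series _) = S_op"
| "symbol_of (Index _) = O_op"

definition num_ops :: "symbol \<Rightarrow> operation list \<Rightarrow> nat" where
  "num_ops X tr = length (filter (\<lambda>p. symbol_of p = X) tr)"

text \<open>
  \<open>Write r c i\<close> writes initial values into series register \<open>r\<close>: the literal \<open>c\<close> at all multiples of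
  the number in index register \<open>i\<close> (only at position 0 if that number is 0), and 0 elsewhere.
  \<open>Shift r i a\<close> multiplies series \<open>a\<close> by the power of \<open>q\<close> whose exponent is in index register \<open>i\<close>;
  with exponent 0 this is copying. \<open>If_Less\<close> and \<open>While_Less\<close> compare two index registers.
\<close>

datatype prog =
    Skip
  | Series nat series_op nat nat
  | Write nat int nat
  | Shift nat nat nat
  | Literal nat nat
  | Compute nat index_op nat nat
  | Seq prog prog
  | If_Less nat nat prog prog
  | While_Less nat nat prog

type_synonym state = "(nat \<Rightarrow> int fps) \<times> (nat \<Rightarrow> nat)"

text \<open>
  \<open>exec N c s tr s'\<close>: program \<open>c\<close>, working with precision \<open>N\<close> and started in state \<open>s\<close>, terminates in
  state \<open>s'\<close>, having performed the operations \<open>tr\<close>.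
\<close>

inductive exec :: "nat \<Rightarrow> prog \<Rightarrow> state \<Rightarrow> operation list \<Rightarrow> state \<Rightarrow> bool" for N where
  Skip: "exec N Skip s [] s"
| Series: "series_defined p (P b) \<Longrightarrow>
    exec N (Series r p a b) (P, k) [Arith p (P a) (P b)]
      (P(r := series_result N p (P a) (P b)), k)"
| Write: "h = fps_cutoff N (Abs_fps (\<lambda>n. if k i dvd n then c else 0)) \<Longrightarrow>
    exec N (Write r c i) (P, k) [Other_Series h] (P(r := h), k)"
| Shift: "h = fps_cutoff N (fps_X ^ k i * P a) \<Longrightarrow>
    exec N (Shift r i a) (P, k) [Other_Series h] (P(r := h), k)"
| Literal: "exec N (Literal r n) (P, k) [Index [n]] (P, k(r := n))"
| Compute: "n = index_result p (k i) (k j) \<Longrightarrow>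
    exec N (Compute r p i j) (P, k) [Index [k i, k j, n]] (P, k(r := n))"
| Seq: "exec N c1 s tr1 s' \<Longrightarrow> exec N c2 s' tr2 s'' \<Longrightarrow> exec N (Seq c1 c2) s (tr1 @ tr2) s''"
| If_True: "k i < k j \<Longrightarrow> exec N c1 (P, k) tr s \<Longrightarrow>
    exec N (If_Less i j c1 c2) (P, k) (Index [k i, k j] # tr) s"
| If_False: "\<not> k i < k j \<Longrightarrow> exec N c2 (P, k) tr s \<Longrightarrow>
    exec N (If_Less i j c1 c2) (P, k) (Index [k i, k j] # tr) s"
| While_True: "k i < k j \<Longrightarrow> exec N c (P, k) tr1 s \<Longrightarrow>
    exec N (While_Less i j c) s tr2 s' \<Longrightarrow>
    exec N (While_Less i j c) (P, k) (Index [k i, k j] # tr1 @ tr2) s'"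
| While_False: "\<not> k i < k j \<Longrightarrow>
    exec N (While_Less i j c) (P, k) [Index [k i, k j]] (P, k)"

lemma exec_deterministic:
  "exec N c s tr s1 \<Longrightarrow> exec N c s tr' s2 \<Longrightarrow> tr' = tr \<and> s2 = s1"
proof (induction arbitrary: tr' s2 rule: exec.induct)
  case (Seq c1 s tr1 s' c2 tr2 s'')
  from Seq.prems show ?case by cases (use Seq.IH in blast)
next
  case (While_True k i j c P tr1 s tr2 s')
  from While_True.prems show ?case by cases (use While_True.IH While_True.hyps in blast)+
next
  case (If_True k i j c1 P tr s c2)
  from If_True.prems show ?case by cases (use If_True.IH If_True.hyps in blast)+
next
  case (If_False k i j c2 P tr s c1)
  from If_False.prems show ?case by cases (use If_False.IH If_False.hyps in blast)+
qed (erule exec.cases; auto)+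

text \<open>The input \<open>N\<close> is given in index register 0; the output is in series register 0.\<close>

definition init_state :: "nat \<Rightarrow> state" where
  "init_state N = ((\<lambda>_. 0), (\<lambda>_. 0)(0 := N))"

definition output_coeff :: "state \<Rightarrow> nat \<Rightarrow> int" where
  "output_coeff s n = fps_nth (fst s 0) n"

text \<open>The bit size of an integer is the number of binary digits of its absolute value.\<close>

definition bit_size :: "int \<Rightarrow> nat" where
  "bit_size c = floorlog 2 (nat \<bar>c\<bar>)"

definition coeffs_within :: "nat \<Rightarrow> nat \<Rightarrow> int fps \<Rightarrow> bool" where
  "coeffs_within N b h \<longleftrightarrow> (\<forall>n<N. bit_size (fps_nth h n) \<le> b)"

definition indices_within :: "nat \<Rightarrow> nat list \<Rightarrow> bool" where
  "indices_within b ns \<longleftrightarrow> (\<forall>n\<in>set ns. bit_size (int n) \<le> b)"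

text \<open>
  Bounds on the sizes of all integers occurring: coefficients of the operands and the result of
  the operations \<^emph>\<open>A\<close>, \<^emph>\<open>M\<close>, \<^emph>\<open>D\<close>, and numbers in the operations \<^emph>\<open>O\<close>. Note that
  \<open>nat \<lfloor>log 2 N\<rfloor> + 1\<close> is the bit size of the input \<open>N\<close> itself.
\<close>

fun arith_within :: "nat \<Rightarrow> nat \<Rightarrow> operation \<Rightarrow> bool" where
  "arith_within N b (Arith p x y) \<longleftrightarrow>
     coeffs_within N b x \<and> coeffs_within N b y \<and> coeffs_within N b (series_result N p x y)"
| "arith_within N b _ \<longleftrightarrow> True"

fun index_within :: "nat \<Rightarrow> operation \<Rightarrow> bool" where
  "index_within b (Index ns) \<longleftrightarrow> indices_within b ns"
| "index_within b _ \<longleftrightarrow> True"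

text \<open>
  \<open>admissible N m p\<close>: \<open>p\<close> is an operation on power series of precision \<open>N\<close> whose operands have
  coefficients of bit size at most \<open>m\<close>, or an operation on numbers not longer than \<open>N\<close>.
\<close>

fun admissible :: "nat \<Rightarrow> nat \<Rightarrow> operation \<Rightarrow> bool" where
  "admissible N m (Arith p x y) \<longleftrightarrow>
     series_defined p y \<and> coeffs_within N m x \<and> coeffs_within N m y"
| "admissible N m (Other_Series h) \<longleftrightarrow> coeffs_within N m h"
| "admissible N m (Index ns) \<longleftrightarrow> indices_within (nat \<lfloor>log 2 N\<rfloor> + 1) ns"

text \<open>
  \<open>cost N p\<close> is the cost of performing operation \<open>p\<close> with precision \<open>N\<close>. The bound \<open>B C N m\<close>, where
  \<open>C\<close> is the implied constant, is required for bit sizes \<open>m = O(N)\<close>. Bit size 1 is subsumed under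
  \<open>m = 2\<close>, as bounds involving \<open>m * ln m\<close> make no sense for \<open>m = 1\<close>.
\<close>

definition cost_bound ::
  "(nat \<Rightarrow> operation \<Rightarrow> nat) \<Rightarrow> symbol \<Rightarrow> (real \<Rightarrow> nat \<Rightarrow> nat \<Rightarrow> real) \<Rightarrow> bool" where
  "cost_bound cost X B \<longleftrightarrow>
     (\<forall>c::real. \<exists>C::real. \<forall>\<^sub>F N in sequentially. \<forall>m p.
        2 \<le> m \<and> real m \<le> c * real N \<and> symbol_of p = X \<and> admissible N m p \<longrightarrow>
        real (cost N p) \<le> B C N m)"

definition ring_cost_model :: "(nat \<Rightarrow> operation \<Rightarrow> nat) \<Rightarrow> bool" where
  "ring_cost_model cost \<longleftrightarrow>
     cost_bound cost A_op (\<lambda>C N m. C * N) \<and>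
     cost_bound cost M_op (\<lambda>C N m. N * ln N * 2 powr (C * log_star N)) \<and>
     cost_bound cost D_op (\<lambda>C N m. N * ln N * 2 powr (C * log_star N)) \<and>
     cost_bound cost S_op (\<lambda>C N m. C * N) \<and>
     cost_bound cost O_op (\<lambda>C N m. C)"

definition bit_cost_model :: "(nat \<Rightarrow> operation \<Rightarrow> nat) \<Rightarrow> bool" where
  "bit_cost_model cost \<longleftrightarrow>
     cost_bound cost A_op (\<lambda>C N m. C * (N * m)) \<and>
     cost_bound cost M_op (\<lambda>C N m. N * ln N * 2 powr (C * log_star N) * (m * ln m)) \<and>
     cost_bound cost D_op (\<lambda>C N m. N ^ 2 * m * ln N ^ 2 * 2 powr (C * log_star N)) \<and>
     cost_bound cost S_op (\<lambda>C N m. C * (N * m)) \<and>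
     cost_bound cost O_op (\<lambda>C N m. C * ln N ^ 2)"

definition total_cost :: "(nat \<Rightarrow> operation \<Rightarrow> nat) \<Rightarrow> nat \<Rightarrow> operation list \<Rightarrow> nat" where
  "total_cost cost N tr = (\<Sum>p\<leftarrow>tr. cost N p)"

end

theory Submission
  imports Defs "HOL-Real_Asymp.Real_Asymp"
begin

text \<open>
  Counting the internal nodes of the tree of a Huffman code level by level shows that \<open>g_t n\<close>
  counts the sequences with sum \<open>n\<close> which start with 1 and grow at most by the factor \<open>t\<close> in
  each step. Splitting off the last level gives a functional equation whose iteration expresses
  the generating function as a quotient of two sums, whose \<open>j\<close>-th summands both vanish up to
  the order \<open>1 + t + \<dots> + t\<^sup>j\<^sup>-\<^sup>1\<close>. Hence \<open>log\<^sub>t N + O(1)\<close> summands suffice, each of which costs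
  one multiplication and two additions, and one division follows. The series
  \<open>1 / (1 - q\<^sup>s)\<close> need no division as they can be written down explicitly.

  The coefficients of the summands count partitions into at most \<open>O(log N)\<close> different
  part sizes. So the operands of the division have only \<open>O((log N)\<^sup>2)\<close> bits although the quotient
  has \<open>O(N)\<close> bits; this yields the fourth power of the logarithm in the bit complexity.
\<close>

unbundle fps_syntax

subsection \<open>Huffman trees level by level\<close>

text \<open>
  The number of nonempty sequences \<open>a\<^sub>1, \<dots>, a\<^sub>k\<close> of positive integers with \<open>a\<^sub>1 \<le> m\<close>,
  \<open>a\<^sub>i\<^sub>+\<^sub>1 \<le> t * a\<^sub>i\<close> and \<open>a\<^sub>1 + \<dots> + a\<^sub>k + e * a\<^sub>k = n\<close>. For \<open>e = 0\<close>, \<open>a\<^sub>i\<close> is the number of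
  internal nodes on level \<open>i\<close> of the tree of a Huffman code.
\<close>

function seqs :: "nat \<Rightarrow> nat \<Rightarrow> nat \<Rightarrow> nat \<Rightarrow> nat" where
  "seqs t e m n = (\<Sum>a = 1..min m n. of_bool (n = (1 + e) * a) + seqs t e (t * a) (n - a))"
  by auto
termination by (relation "measure (\<lambda>(t, e, m, n). n)") auto

declare seqs.simps [simp del]

text \<open>\<open>f_t t r\<close> is the size of \<open>kraft t 1 r\<close>. The value
  \<open>m\<close> counts the roots of a forest, so that removing the top level of a tree stays
  inside the family.\<close>

definition kraft :: "nat \<Rightarrow> nat \<Rightarrow> nat \<Rightarrow> int list set" where
  "kraft t m r = {xs. length xs = r \<and> (\<forall>x\<in>set xs. 0 \<le> x) \<and> sorted xs \<and>
                      (\<Sum>x\<leftarrow>xs. 1 / real t powi x) = real m}"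

text \<open>A new top level of a forest: \<open>z\<close> roots are leaves, and every old leaf
  becomes one level deeper.\<close>

definition add_level :: "nat \<Rightarrow> int list \<Rightarrow> int list" where
  "add_level z xs = replicate z 0 @ map (\<lambda>x. x + 1) xs"

lemma kraft_sum_add_level:
  assumes "t > 0"
  shows "(\<Sum>x\<leftarrow>add_level z xs. 1 / real t powi x) = real z + (\<Sum>x\<leftarrow>xs. 1 / real t powi x) / t"
proof -
  have "(\<Sum>x\<leftarrow>map (\<lambda>x. x + 1) xs. 1 / real t powi x) = (\<Sum>x\<leftarrow>xs. 1 / real t powi x) / t"
    using assms by (induction xs) (auto simp: power_int_add field_simps)
  then show ?thesis
    by (simp add: add_level_def sum_list_replicate)
qed

lemma kraft_sum_pos:
  assumes "t > 0" "xs \<noteq> []"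
  shows "(\<Sum>x\<leftarrow>xs. 1 / real t powi x) > 0"
  using assms(2)
proof (induction xs rule: list_nonempty_induct)
  case (cons x xs)
  then show ?case using assms by (simp add: add_pos_pos)
qed (use assms in simp)

lemma kraft_sum_le_length:
  assumes "t > 0" "\<forall>x\<in>set xs. 0 \<le> x"
  shows "(\<Sum>x\<leftarrow>xs. 1 / real t powi x) \<le> length xs"
  using assms(2)
proof (induction xs)
  case (Cons x xs)
  have "1 \<le> real t powi x" using Cons.prems assms(1) by (auto simp: power_int_def)
  then have "1 / real t powi x \<le> 1" by simp
  then show ?case using Cons by simp
qed simp

text \<open>Zeros form a prefix of a sorted list of nonnegative integers; \<open>z\<close> is their
  number, and the other entries are at least 1 and can be lowered by 1.\<close>

lemma add_level_surj:
  assumes "sorted xs" "\<forall>x\<in>set xs. 0 \<le> x"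
  obtains z ys where "xs = add_level z ys" "sorted ys" "\<forall>y\<in>set ys. 0 \<le> y"
proof -
  define ds where "ds = dropWhile (\<lambda>x. x = 0) xs"
  define z where "z = length (takeWhile (\<lambda>x. x = 0) xs)"
  have tw: "takeWhile (\<lambda>x. x = 0) xs = replicate z 0"
    unfolding z_def by (rule replicate_eqI) (auto dest: set_takeWhileD)
  have sd: "sorted ds" using assms(1) by (simp add: ds_def sorted_dropWhile)
  have ge: "1 \<le> x" if "x \<in> set ds" for x
  proof -
    from that obtain y l where l: "ds = y # l" by (cases ds) auto
    then have "y \<noteq> 0" unfolding ds_def by (simp add: dropWhile_eq_Cons_conv)
    moreover have "y \<ge> 0" using l assms(2) unfolding ds_def by (metis list.set_intros(1) set_dropWhileD)
    moreover have "y \<le> x" using sd that unfolding l by auto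
    ultimately show ?thesis by linarith
  qed
  define ys where "ys = map (\<lambda>x. x - 1) ds"
  have "xs = add_level z ys"
    unfolding add_level_def ys_def using takeWhile_dropWhile_id[of "\<lambda>x. x = 0" xs]
    by (simp add: tw comp_def ds_def)
  moreover have "sorted ys" using sd by (simp add: ys_def sorted_map sorted_wrt_mono_rel[of _ "(\<le>)"])
  moreover have "\<forall>y\<in>set ys. 0 \<le> y" using ge by (fastforce simp: ys_def)
  ultimately show ?thesis by (rule that)
qed

lemma add_level_inject:
  assumes "\<forall>x\<in>set xs. 0 \<le> x" "\<forall>y\<in>set ys. 0 \<le> y"
  shows "add_level z xs = add_level z' ys \<longleftrightarrow> z = z' \<and> xs = ys"
proof -
  have *: "length (filter (\<lambda>x. x = 0) (add_level w us)) = w" if "\<forall>x\<in>set us. 0 \<le> x" for w us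
    using that by (induction us) (auto simp: add_level_def)
  show ?thesis
  proof
    assume eq: "add_level z xs = add_level z' ys"
    then have z: "z = z'" using * assms by metis
    then have "map (\<lambda>x. x + 1) xs = map (\<lambda>x. x + 1) ys" using eq by (simp add: add_level_def)
    then show "z = z' \<and> xs = ys" using z by (simp add: inj_map_eq_map inj_def)
  qed simp
qed

text \<open>Of the \<open>m\<close> roots, \<open>a\<close> are internal nodes. The
  \<open>m - a\<close> zeros contribute \<open>m - a\<close> to the sum, so the other entries
  contribute \<open>a\<close>, which becomes \<open>t * a\<close> when they are lowered by
  1.\<close>

lemma kraft_levels:
  assumes "t > 0" "m \<le> r"
  shows "kraft t m r = (\<Union>a\<le>m. add_level (m - a) ` kraft t (t * a) (r - (m - a)))"
proof (intro equalityI subsetI)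
  fix xs assume xs: "xs \<in> kraft t m r"
  then obtain z ys where ys: "xs = add_level z ys" "sorted ys" "\<forall>y\<in>set ys. 0 \<le> y"
    using add_level_surj[of xs] by (auto simp: kraft_def)
  let ?s = "\<Sum>x\<leftarrow>ys. 1 / real t powi x"
  have s: "real z + ?s / t = m"
    using xs kraft_sum_add_level[OF assms(1), of z ys] by (simp add: kraft_def ys(1))
  have "?s \<ge> 0" using kraft_sum_pos[OF assms(1), of ys] by (cases "ys = []") auto
  then have "?s / t \<ge> 0" by simp
  then have zm: "z \<le> m" using s by linarith
  then have "?s = t * real (m - z)" using s assms(1) by (simp add: field_simps of_nat_diff)
  then have "ys \<in> kraft t (t * (m - z)) (r - z)"
    using xs ys by (auto simp: kraft_def add_level_def)
  then show "xs \<in> (\<Union>a\<le>m. add_level (m - a) ` kraft t (t * a) (r - (m - a)))"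
    using zm ys(1) by (intro UN_I[of "m - z"]) auto
next
  fix xs assume "xs \<in> (\<Union>a\<le>m. add_level (m - a) ` kraft t (t * a) (r - (m - a)))"
  then obtain a ys where ys: "a \<le> m" "ys \<in> kraft t (t * a) (r - (m - a))" "xs = add_level (m - a) ys"
    by auto
  have "(\<Sum>x\<leftarrow>xs. 1 / real t powi x) = real m"
    using ys assms(1) unfolding ys(3) kraft_sum_add_level[OF assms(1)]
    by (simp add: kraft_def of_nat_diff)
  moreover have "length xs = r" "\<forall>x\<in>set xs. 0 \<le> x"
    using ys assms by (auto simp: add_level_def kraft_def)
  moreover have "sorted xs" using ys
    by (auto simp: add_level_def kraft_def sorted_append sorted_map intro: sorted_wrt_mono_rel[of _ "(\<le>)"])
  ultimately show "xs \<in> kraft t m r" by (auto simp: kraft_def)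
qed

lemma kraft_0:
  assumes "t > 0"
  shows "kraft t 0 r = (if r = 0 then {[]} else {})"
proof -
  have "xs = []" if "xs \<in> kraft t 0 r" for xs
    using that kraft_sum_pos[OF assms, of xs] by (auto simp: kraft_def)
  then show ?thesis by (auto simp: kraft_def)
qed

lemma kraft_empty:
  assumes "t > 0" "r < m"
  shows "kraft t m r = {}"
proof -
  have "real m \<le> real r" if "xs \<in> kraft t m r" for xs
    using that kraft_sum_le_length[OF assms(1), of xs] by (auto simp: kraft_def)
  then show ?thesis using assms(2) by auto
qed

text \<open>Here \<open>n\<close> is the number of internal nodes, each of which replaces one leaf
  by \<open>t\<close> leaves. Removing the top level leaves \<open>t * a\<close> roots and
  \<open>n - a\<close> internal nodes, which is the recursion of \<open>seqs\<close>. The term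
  \<open>of_bool (n = 0)\<close> stands for the empty sequence, which \<open>seqs\<close> does not
  count.\<close>

lemma card_kraft:
  assumes t: "t \<ge> 2"
  shows "finite (kraft t m (m + n * (t - 1))) \<and>
    card (kraft t m (m + n * (t - 1))) = of_bool (n = 0) + seqs t 0 m n"
proof (induction n arbitrary: m rule: less_induct)
  case (less n)
  let ?K = "\<lambda>a. kraft t (t * a) (a + n * (t - 1))"
  have t0: "t > 0" using t by simp
  have K: "kraft t m (m + n * (t - 1)) = (\<Union>a\<le>m. add_level (m - a) ` ?K a)"
    unfolding kraft_levels[OF t0 le_add1]
    by (intro SUP_cong refl arg_cong[where f = "image _"] arg_cong[where f = "kraft t _"]) auto
  have K0: "?K 0 = (if n = 0 then {[]} else {})" using t by (simp add: kraft_0)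
  have Kpos: "finite (?K a) \<and> card (?K a) = of_bool (n = a) + seqs t 0 (t * a) (n - a)"
    if "1 \<le> a" "a \<le> n" for a
  proof -
    from that obtain d where d: "n = a + d" using le_Suc_ex by blast
    have "a + n * (t - 1) = t * a + (n - a) * (t - 1)"
      using t by (cases t) (auto simp: d algebra_simps)
    then show ?thesis using less[of "n - a" "t * a"] that by auto
  qed
  \<comment> \<open>There would be fewer leaves than the \<open>t * a\<close> roots. This produces
    the upper limit \<open>min m n\<close> of the sum in \<open>seqs\<close>.\<close>
  have Kbig: "?K a = {}" if "n < a" for a
  proof (rule kraft_empty[OF t0])
    have "n * (t - 1) < a * (t - 1)" using that t by simp
    then show "a + n * (t - 1) < t * a" using t by (cases t) (auto simp: algebra_simps)
  qed
  have fin: "finite (?K a)" for a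
    using Kpos[of a] Kbig[of a] K0 by (cases "a = 0"; cases "a \<le> n") auto
  have nonneg: "\<forall>x\<in>set xs. 0 \<le> x" if "xs \<in> ?K a" for xs a
    using that by (auto simp: kraft_def)
  have "card (kraft t m (m + n * (t - 1))) = (\<Sum>a\<le>m. card (add_level (m - a) ` ?K a))"
    unfolding K
  proof (rule card_UN_disjoint)
    show "\<forall>a\<in>{..m}. \<forall>b\<in>{..m}. a \<noteq> b \<longrightarrow>
        add_level (m - a) ` ?K a \<inter> add_level (m - b) ` ?K b = {}"
    proof (intro ballI impI equals0I)
      fix a b xs
      assume ab: "a \<in> {..m}" "b \<in> {..m}" "a \<noteq> b"
        and "xs \<in> add_level (m - a) ` ?K a \<inter> add_level (m - b) ` ?K b"
      then obtain us vs where "us \<in> ?K a" "vs \<in> ?K b" "add_level (m - a) us = add_level (m - b) vs"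
        by auto
      then have "m - a = m - b" using add_level_inject nonneg by blast
      then show False using ab by auto
    qed
  qed (use fin in auto)
  also have "\<dots> = (\<Sum>a\<le>m. card (?K a))"
    by (intro sum.cong refl card_image inj_onI) (use add_level_inject nonneg in blast)
  also have "\<dots> = card (?K 0) + (\<Sum>a = 1..m. card (?K a))"
    by (simp add: atMost_atLeast0 sum.atLeast_Suc_atMost)
  also have "(\<Sum>a = 1..m. card (?K a)) = (\<Sum>a = 1..min m n. card (?K a))"
    using Kbig by (intro sum.mono_neutral_right) (auto simp: not_le)
  also have "\<dots> = seqs t 0 m n"
    unfolding seqs.simps[of t 0 m n] using Kpos by (intro sum.cong) auto
  finally have "card (kraft t m (m + n * (t - 1))) = of_bool (n = 0) + seqs t 0 m n"
    unfolding K0 by simp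
  moreover have "finite (kraft t m (m + n * (t - 1)))" unfolding K using fin by auto
  ultimately show ?case by simp
qed

lemma g_t_eq_seqs: "t \<ge> 2 \<Longrightarrow> g_t t n = of_bool (n = 0) + seqs t 0 1 n"
  using card_kraft[of t 1 n] by (simp add: g_t_def f_t_def kraft_def)

section \<open>Growth of \<open>g_t\<close>\<close>

lemma seqs_mono: "m \<le> m' \<Longrightarrow> seqs t e m n \<le> seqs t e m' n"
  unfolding seqs.simps[of t e m n] seqs.simps[of t e m' n] by (intro sum_mono2) auto

lemma g_t_0: "t \<ge> 2 \<Longrightarrow> g_t t 0 = 1"
  by (subst g_t_eq_seqs, simp, subst seqs.simps) simp

lemma g_t_Suc:
  assumes "t \<ge> 2"
  shows "g_t t (Suc n) = of_bool (n = 0) + seqs t 0 t n"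
proof -
  have "{1..min 1 (Suc n)} = {1}" by auto
  then show ?thesis
    unfolding g_t_eq_seqs[OF assms] seqs.simps[of t 0 1 "Suc n"] by simp
qed

text \<open>After the first entry 1 the second may be 1 or 2, as \<open>t \<ge> 2\<close>. Second
  entry 1 gives \<open>g_t t (Suc (Suc n))\<close>. Second entry 2 leaves the sum \<open>n\<close>
  and a larger range for the next entry, hence gives at least \<open>g_t t (Suc n)\<close>.\<close>

lemma g_t_fib:
  assumes "t \<ge> 2"
  shows "g_t t (Suc n) + g_t t (Suc (Suc n)) \<le> g_t t (Suc (Suc (Suc n)))"
proof -
  let ?f = "\<lambda>a. of_bool (Suc (Suc n) = a) + seqs t 0 (t * a) (Suc (Suc n) - a)"
  have "seqs t 0 t n \<le> seqs t 0 (t * 2) n" by (rule seqs_mono) simp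
  then have "g_t t (Suc n) + g_t t (Suc (Suc n)) \<le> sum ?f {1, 2}"
    using assms by (simp add: g_t_Suc)
  also have "\<dots> \<le> sum ?f {1..min t (Suc (Suc n))}" using assms by (intro sum_mono2) auto
  also have "\<dots> = g_t t (Suc (Suc (Suc n)))" using assms by (simp add: g_t_Suc seqs.simps[of t 0 t "Suc (Suc n)"])
  finally show ?thesis .
qed

lemma g_t_mono: "t \<ge> 2 \<Longrightarrow> m \<le> n \<Longrightarrow> g_t t m \<le> g_t t n"
proof (rule lift_Suc_mono_le[of "g_t t"])
  fix n assume t: "t \<ge> 2"
  show "g_t t n \<le> g_t t (Suc n)"
  proof (cases n)
    case 0
    then show ?thesis using t by (simp add: g_t_0 g_t_Suc)
  next
    case (Suc k)
    then show ?thesis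
      using g_t_fib[OF t, of "k - 1"] t g_t_0[OF t] g_t_Suc[OF t, of 0] g_t_Suc[OF t, of 1]
      by (cases k) (auto simp: seqs.simps[of t 0 t "Suc 0"] seqs.simps[of t 0 t 0])
  qed
qed

lemma g_t_doubling: "t \<ge> 2 \<Longrightarrow> 2 * g_t t n \<le> g_t t (n + 3)"
  using g_t_fib[of t n] g_t_mono[of t n "Suc n"] g_t_mono[of t n "Suc (Suc n)"]
  unfolding numeral_3_eq_3 add_Suc_right add_0_right by linarith

subsection \<open>The generating function\<close>

text \<open>For \<open>s > 0\<close> this is \<open>1 / (1 - fps_X ^ s)\<close>, in the explicit
  form that \<open>Write\<close> produces up to sign.\<close>

definition multiples :: "nat \<Rightarrow> int fps" where
  "multiples s = Abs_fps (\<lambda>n. if s dvd n then 1 else 0)"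

lemma multiples_geometric:
  assumes "s > 0"
  shows "multiples s = 1 + fps_X ^ s * multiples s"
proof (rule fps_ext)
  fix n
  have "s dvd n \<longleftrightarrow> n = 0 \<or> s \<le> n \<and> s dvd (n - s)"
    using assms by (auto simp: dvd_imp_le dvd_minus_self)
  then show "multiples s $ n = (1 + fps_X ^ s * multiples s) $ n"
    using assms by (auto simp: multiples_def fps_X_power_mult_nth)
qed

lemma multiples_finite_geometric:
  assumes "s > 0"
  shows "multiples s * (1 - fps_X ^ (s * k)) = (\<Sum>i<k. fps_X ^ (s * i))"
proof (induction k)
  case (Suc k)
  have "multiples s * (1 - fps_X ^ (s * Suc k)) =
      multiples s * (1 - fps_X ^ (s * k)) + (multiples s - fps_X ^ s * multiples s) * fps_X ^ (s * k)"
    by (simp add: algebra_simps power_add)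
  also have "multiples s - fps_X ^ s * multiples s = 1"
    using multiples_geometric[OF assms] by (simp add: algebra_simps)
  finally show ?case using Suc by simp
qed simp

lemma sum_fps_X_powers:
  assumes "s > 0"
  shows "(\<Sum>a = 1..k. fps_X ^ (s * a)) = fps_X ^ s * multiples s * (1 - fps_X ^ (s * k))"
  by (simp add: mult.assoc multiples_finite_geometric[OF assms] sum_distrib_left
      sum.atLeast_Suc_atMost_Suc_shift lessThan_atLeast0 sum.atLeast1_atMost_eq flip: power_add)

definition seqs_gf :: "nat \<Rightarrow> nat \<Rightarrow> nat \<Rightarrow> int fps" where
  "seqs_gf t e m = Abs_fps (\<lambda>n. int (seqs t e m n))"

lemma seqs_gf_first:
  "seqs_gf t e m = (\<Sum>a = 1..m. fps_X ^ ((1 + e) * a) + fps_X ^ a * seqs_gf t e (t * a))"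
proof (rule fps_ext)
  fix n
  \<comment> \<open>Summands with \<open>a > n\<close> are zero, so the limit \<open>min m n\<close>
    can be replaced by \<open>m\<close>, which is the same for all coefficients.\<close>
  let ?f = "\<lambda>a. of_bool (n = (1 + e) * a) + (if a \<le> n then int (seqs t e (t * a) (n - a)) else 0)"
  have "int (seqs t e m n) = sum ?f {1..min m n}"
    by (subst seqs.simps) (auto intro!: sum.cong)
  also have "\<dots> = sum ?f {1..m}"
    by (rule sum.mono_neutral_left) auto
  finally show "seqs_gf t e m $ n =
      (\<Sum>a = 1..m. fps_X ^ ((1 + e) * a) + fps_X ^ a * seqs_gf t e (t * a)) $ n"
    by (simp add: fps_sum_nth seqs_gf_def fps_X_power_mult_nth not_less if_distrib cong: if_cong)
       (auto intro!: sum.cong)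
qed

text \<open>The recursion expresses the coefficient of index \<open>n\<close> by coefficients of
  index \<open>n - a\<close> with \<open>a \<ge> 1\<close>, so this homogeneous equation has only
  the zero solution.\<close>

lemma seqs_gf_unique:
  fixes d :: "nat \<Rightarrow> int fps"
  assumes d: "\<And>m. d m = (\<Sum>a = 1..m. fps_X ^ a * d (t * a))"
  shows "d m = 0"
proof -
  have "d m $ n = 0" for n
  proof (induction n arbitrary: m rule: less_induct)
    case (less n)
    have "(fps_X ^ a * d (t * a)) $ n = 0" if "a \<in> {1..m}" for a
      using that less[of "n - a" "t * a"] by (auto simp: fps_X_power_mult_nth)
    then show ?case by (subst d) (simp add: fps_sum_nth)
  qed
  then show ?thesis by (simp add: fps_eq_iff)
qed

text \<open>Splitting off the last entry instead of the first: both sides satisfy the recursion for the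
  first entry, which has a unique solution.\<close>

lemma seqs_gf_last:
  fixes t e m :: nat
  defines "s \<equiv> 1 + e"
  defines "w \<equiv> fps_X ^ s * multiples s"
  shows "seqs_gf t e m = (\<Sum>a = 1..m. fps_X ^ (s * a)) + w * (seqs_gf t 0 m - seqs_gf t (t * s) m)"
proof -
  let ?T = "\<lambda>m. \<Sum>a = 1..m. fps_X ^ (s * a) :: int fps"
  let ?R = "\<lambda>m. ?T m + w * (seqs_gf t 0 m - seqs_gf t (t * s) m)"
  \<comment> \<open>If \<open>c\<close> is the entry before the last one, the last entry runs over
    \<open>1..t * c\<close> and contributes \<open>w - w * fps_X ^ (s * (t * c))\<close>. The second
    term gives \<open>c\<close> the additional weight \<open>t * s\<close>, which explains the
    weights 0 and \<open>t * s\<close> in the claim.\<close>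
  have T: "?T k = w - w * fps_X ^ (s * k)" for k
    unfolding w_def by (subst sum_fps_X_powers) (auto simp: s_def algebra_simps)
  \<comment> \<open>In \<open>fps_X ^ a * ?R (t * a)\<close> the closed form \<open>T\<close>
    supplies \<open>w * (fps_X ^ a - fps_X ^ ((1 + t * s) * a))\<close>: the terms of the one-entry
    sequences in the recursions for the weights 0 and \<open>t * s\<close>.\<close>
  have step: "?R m = (\<Sum>a = 1..m. fps_X ^ (s * a) + fps_X ^ a * ?R (t * a))" for m
  proof -
    have "(\<Sum>a = 1..m. fps_X ^ (s * a) + fps_X ^ a * ?R (t * a)) = ?T m +
       w * (\<Sum>a = 1..m. (fps_X ^ a + fps_X ^ a * seqs_gf t 0 (t * a)) -
            (fps_X ^ ((1 + t * s) * a) + fps_X ^ a * seqs_gf t (t * s) (t * a)))"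
      unfolding sum.distrib T[of "t * _"] sum_distrib_left
      by (intro arg_cong2[where f = "(+)"] sum.cong refl) (simp add: algebra_simps power_add)
    also have "\<dots> = ?R m"
      by (subst sum_subtractf)
         (simp only: seqs_gf_first[of t 0 m, unfolded add_0_right mult_1] seqs_gf_first[of t "t * s" m])
    finally show ?thesis by simp
  qed
  have "seqs_gf t e m - ?R m = 0"
    by (rule seqs_gf_unique[where d = "\<lambda>m. seqs_gf t e m - ?R m" and t = t], subst step, subst seqs_gf_first)
       (simp add: s_def flip: sum_subtractf, simp add: algebra_simps)
  then show ?thesis by simp
qed

section \<open>Iteration of the functional equation\<close>

fun repunit :: "nat \<Rightarrow> nat \<Rightarrow> nat" where
  "repunit t 0 = 0"
| "repunit t (Suc j) = t * repunit t j + 1"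

text \<open>In the usual notation, \<open>(-1)\<^sup>j \<Prod>\<^sub>i q\<^sup>[\<^sup>i\<^sup>] / (1 - q\<^sup>[\<^sup>i\<^sup>])\<close> for \<open>1 \<le> i \<le> j\<close>, with
  \<open>[i] = 1 + t + \<dots> + t\<^sup>i\<^sup>-\<^sup>1\<close>; carrying the sign along makes all summations of the program additions.\<close>

fun signed_product :: "nat \<Rightarrow> nat \<Rightarrow> int fps" where
  "signed_product t 0 = 1"
| "signed_product t (Suc j) =
     signed_product t j * - (fps_X ^ repunit t (Suc j) * multiples (repunit t (Suc j)))"

definition denominator :: "nat \<Rightarrow> nat \<Rightarrow> int fps" where
  "denominator t J = (\<Sum>j\<le>J. signed_product t j)"

definition numerator :: "nat \<Rightarrow> nat \<Rightarrow> int fps" where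
  "numerator t J = (\<Sum>j\<le>J. fps_X ^ repunit t j * signed_product t j)"

text \<open>For \<open>e = t * repunit t j\<close>, \<open>1 + e\<close> is
  \<open>repunit t (Suc j)\<close> and the new weight has the same form with \<open>Suc j\<close>.
  Splitting repeatedly, starting from weight 0, meets only these weights.\<close>

lemma seqs_gf_level:
  "seqs_gf t (t * repunit t j) 1 = fps_X ^ repunit t (Suc j) +
     fps_X ^ repunit t (Suc j) * multiples (repunit t (Suc j)) *
       (seqs_gf t 0 1 - seqs_gf t (t * repunit t (Suc j)) 1)"
  using seqs_gf_last[of t "t * repunit t j" 1] by simp

text \<open>Each step replaces the series of the current weight by that of the next one. The
  multiples of \<open>1 + seqs_gf t 0 1\<close> produced on the way are collected in
  \<open>denominator\<close>.\<close>

lemma generating_function_remainder: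
  "(1 + seqs_gf t 0 1) * denominator t J =
     numerator t J + signed_product t J * seqs_gf t (t * repunit t J) 1"
proof (induction J)
  case 0
  show ?case by (simp add: denominator_def numerator_def)
next
  case (Suc J)
  define X where "X = (fps_X :: int fps) ^ repunit t (Suc J)"
  define w where "w = X * multiples (repunit t (Suc J))"
  have 1: "seqs_gf t (t * repunit t J) 1 = X + w * (seqs_gf t 0 1 - seqs_gf t (t * repunit t (Suc J)) 1)"
    unfolding X_def w_def by (rule seqs_gf_level)
  have "multiples (repunit t (Suc J)) = 1 + w"
    unfolding w_def X_def by (rule multiples_geometric) simp
  then have 2: "w = X + X * w"
    by (metis w_def distrib_left mult.right_neutral)
  have 3: "signed_product t (Suc J) = - (signed_product t J * w)"
    by (simp add: w_def X_def)
  have "(1 + seqs_gf t 0 1) * denominator t (Suc J) =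
     numerator t J + signed_product t J * (seqs_gf t (t * repunit t J) 1 - (1 + seqs_gf t 0 1) * w)"
    using Suc by (simp add: denominator_def 3 algebra_simps del: repunit.simps signed_product.simps)
  also have "seqs_gf t (t * repunit t J) 1 - (1 + seqs_gf t 0 1) * w =
     - (w * seqs_gf t (t * repunit t (Suc J)) 1) - (w - X)"
    unfolding 1 by (simp add: algebra_simps)
  \<comment> \<open>Writing \<open>seqs_gf t 0 1\<close> as the full series minus 1 leaves
    \<open>X - w\<close>. Being \<open>- (X * w)\<close>, it makes the new summand of
    \<open>numerator\<close> a shifted \<open>signed_product\<close>.\<close>
  also have "w - X = X * w" using 2 by (metis add_diff_cancel_left')
  also have "numerator t J + signed_product t J *
      (- (w * seqs_gf t (t * repunit t (Suc J)) 1) - X * w) =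
     numerator t (Suc J) + signed_product t (Suc J) * seqs_gf t (t * repunit t (Suc J)) 1"
    unfolding 3 by (simp add: numerator_def 3 X_def[symmetric] algebra_simps del: repunit.simps signed_product.simps)
  finally show ?case .
qed

lemma fps_X_power_dvd_nth:
  fixes f :: "'a :: comm_ring_1 fps"
  assumes "fps_X ^ k dvd f" "n < k"
  shows "f $ n = 0"
  using assms by (auto elim!: dvdE simp: fps_X_power_mult_nth)

text \<open>The entries are positive and the last one counts \<open>1 + e\<close> times, so each
  weighted sum is at least \<open>1 + e\<close>.\<close>

lemma seqs_gf_dvd: "fps_X ^ (1 + e) dvd seqs_gf t e 1"
proof -
  have "seqs t e m n = 0" if "n < 1 + e" for m n
    using that
  proof (induction n arbitrary: m rule: less_induct)
    case (less n)
    have "of_bool (n = (1 + e) * a) + seqs t e (t * a) (n - a) = 0" if "a \<in> {1..min m n}" for a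
    proof -
      have "(1 + e) * 1 \<le> (1 + e) * a" using that by (intro mult_le_mono) auto
      then have "n \<noteq> (1 + e) * a" using less.prems by (metis mult.right_neutral not_le)
      moreover have "seqs t e (t * a) (n - a) = 0"
        by (rule less.IH) (use that less.prems in auto)
      ultimately show ?thesis by simp
    qed
    then show ?case by (subst seqs.simps) (rule sum.neutral, blast)
  qed
  then have "seqs_gf t e 1 = fps_X ^ (1 + e) * fps_shift (1 + e) (seqs_gf t e 1)"
    by (intro fps_ext) (auto simp: fps_X_power_mult_nth seqs_gf_def simp del: One_nat_def power_Suc plus_1_eq_Suc)
  then show ?thesis by (metis dvd_triv_left)
qed

text \<open>The factor \<open>seqs_gf\<close> makes the remainder divisible by
  \<open>fps_X ^ repunit t (Suc J)\<close>, so it does not affect coefficients below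
  \<open>N\<close>.\<close>

lemma generating_function_truncated:
  assumes "t \<ge> 2" "N \<le> repunit t (Suc J)" "n < N"
  shows "(Abs_fps (\<lambda>n. int (g_t t n)) * denominator t J) $ n = numerator t J $ n"
proof -
  have "Abs_fps (\<lambda>n. int (g_t t n)) = 1 + seqs_gf t 0 1"
    by (rule fps_ext) (simp add: seqs_gf_def g_t_eq_seqs assms(1))
  moreover have "fps_X ^ (repunit t (Suc J)) dvd signed_product t J * seqs_gf t (t * repunit t J) 1"
    using seqs_gf_dvd[of "t * repunit t J" t] by (simp add: dvd_mult)
  moreover have "n < repunit t (Suc J)" using assms(2,3) by linarith
  ultimately show ?thesis
    by (simp add: generating_function_remainder fps_X_power_dvd_nth[of "repunit t (Suc J)"]
        del: repunit.simps One_nat_def)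
qed

lemma denominator_0: "denominator t J $ 0 = 1"
proof -
  have "signed_product t (Suc j) $ 0 = 0" for j by simp
  then have "(\<Sum>j\<in>{..J} - {0}. signed_product t j $ 0) = 0"
    by (intro sum.neutral) (metis DiffE insertI1 not0_implies_Suc)
  then show ?thesis by (simp add: denominator_def fps_sum_nth sum.remove[of _ 0])
qed

text \<open>The coefficients of a product up to \<open>n\<close> depend only on those of the factors
  up to \<open>n\<close>, so cutting off at \<open>N > n\<close> leaves this coefficient of the
  quotient unchanged.\<close>

lemma generating_function_quotient:
  assumes "t \<ge> 2" "N \<le> repunit t (Suc J)" "n < N"
  shows "series_result N Div (fps_cutoff N (numerator t J)) (fps_cutoff N (denominator t J)) $ n
     = int (g_t t n)"
proof -
  define G where "G = Abs_fps (\<lambda>n. int (g_t t n))"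
  define A where "A = fps_cutoff N (numerator t J)"
  define B where "B = fps_cutoff N (denominator t J)"
  define R where "R = fps_right_inverse B (B $ 0)"
  have B0: "B $ 0 = 1" using assms by (simp add: B_def denominator_0)
  have BR: "B * R = 1"
    unfolding R_def by (rule fps_right_inverse) (simp add: B0)
  have "A $ k = (G * B) $ k" if "k \<le> n" for k
  proof -
    have "(G * B) $ k = (G * denominator t J) $ k"
      unfolding fps_mult_nth using that assms(3) by (intro sum.cong) (auto simp: B_def)
    then show ?thesis
      using that assms generating_function_truncated[of t N J k] by (simp add: A_def G_def)
  qed
  then have "(A * R) $ n = (G * B * R) $ n"
    unfolding fps_mult_nth[of A] fps_mult_nth[of "G * B"] by simp
  also have "\<dots> = G $ n" using BR by (simp add: mult.assoc)
  finally show ?thesis using assms by (simp add: G_def A_def B_def R_def)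
qed

subsection \<open>Size of the coefficients\<close>

text \<open>The unsigned version of \<open>signed_product\<close>. Coefficient \<open>n\<close>
  counts the ways to write \<open>n\<close> as a sum of \<open>c i * repunit t i\<close> over
  \<open>1 \<le> i \<le> j\<close> with all \<open>c i\<close> positive.\<close>

fun rep_product :: "nat \<Rightarrow> nat \<Rightarrow> int fps" where
  "rep_product t 0 = 1"
| "rep_product t (Suc j) =
     rep_product t j * (fps_X ^ repunit t (Suc j) * multiples (repunit t (Suc j)))"

lemma signed_product_eq: "signed_product t j = (- 1) ^ j * rep_product t j"
  by (induction j) (simp_all add: algebra_simps del: repunit.simps)

text \<open>Remove one copy of the part \<open>repunit t (Suc j)\<close>: either it was the only
  one, or at least one is left.\<close>

lemma rep_product_Suc_rec:
  "rep_product t (Suc j) = fps_X ^ repunit t (Suc j) * (rep_product t j + rep_product t (Suc j))"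
proof -
  define s where "s = repunit t (Suc j)"
  have "multiples s = 1 + fps_X ^ s * multiples s"
    by (rule multiples_geometric) (simp add: s_def)
  then have "rep_product t j * (fps_X ^ s * multiples s) =
      fps_X ^ s * (rep_product t j + rep_product t j * (fps_X ^ s * multiples s))"
    by (metis distrib_left mult.left_commute mult.right_neutral)
  then show ?thesis by (simp add: s_def)
qed

lemma rep_product_Suc_nth:
  "rep_product t (Suc j) $ n = (if n < repunit t (Suc j) then 0
     else rep_product t j $ (n - repunit t (Suc j)) + rep_product t (Suc j) $ (n - repunit t (Suc j)))"
  by (subst rep_product_Suc_rec) (simp add: fps_X_power_mult_nth del: rep_product.simps repunit.simps)

lemma rep_product_nonneg: "rep_product t j $ n \<ge> 0"
proof (induction j arbitrary: n)
  case (Suc j)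
  show ?case
  proof (induction n rule: less_induct)
    case (less n)
    then show ?case
      using Suc by (subst rep_product_Suc_nth) (simp add: del: rep_product.simps)
  qed
qed simp

lemma rep_product_1_nth: "rep_product t (Suc 0) $ n = of_bool (n \<ge> 1)"
  by (induction n) (subst rep_product_Suc_nth, simp del: rep_product.simps, subst rep_product_Suc_nth, simp)+

text \<open>For one factor the coefficients are 0, 1, 1, ..., and the recursion preserves
  monotonicity. The empty product is 1 and not monotone, hence \<open>Suc j\<close>.\<close>

lemma rep_product_Suc_mono:
  assumes "m \<le> n"
  shows "rep_product t (Suc j) $ m \<le> rep_product t (Suc j) $ n"
  using assms
proof (rule lift_Suc_mono_le[rotated])
  show "rep_product t (Suc j) $ n \<le> rep_product t (Suc j) $ Suc n" for n
  proof (induction j arbitrary: n)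
    case 0
    show ?case by (simp add: rep_product_1_nth del: rep_product.simps)
  next
    case (Suc j)
    note IH = Suc.IH
    show ?case
    proof (induction n rule: less_induct)
      case (less n)
      let ?s = "repunit t (Suc (Suc j))"
      show ?case
      proof (cases "n < ?s")
        case True
        then show ?thesis by (subst rep_product_Suc_nth) (simp add: rep_product_nonneg del: rep_product.simps repunit.simps)
      next
        case False
        have "?s > 0" by simp
        then have "rep_product t (Suc (Suc j)) $ (n - ?s) \<le> rep_product t (Suc (Suc j)) $ Suc (n - ?s)"
          using less[of "n - ?s"] False by linarith
        then show ?thesis
          using IH[of "n - ?s"] False unfolding rep_product_Suc_nth[of t "Suc j" n] rep_product_Suc_nth[of t "Suc j" "Suc n"]
          by (simp add: Suc_diff_le not_less del: rep_product.simps repunit.simps)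
      qed
    qed
  qed
qed

text \<open>Monotonicity turns the recursion for the products into \<open>Q n \<le> 2 * Q (n - 3)\<close> for the sum
  \<open>Q\<close> of their coefficients, whereas \<open>g_t\<close> at least doubles in three steps.\<close>

lemma sum_product_le_g_t:
  assumes t: "t \<ge> 2"
  shows "(\<Sum>j\<le>J. rep_product t j $ n) \<le> int (g_t t (n + 1))"
proof -
  \<comment> \<open>The summand \<open>j = 0\<close> lacks monotonicity. It is nonzero only at
    \<open>n = 0\<close> and is added at the end.\<close>
  define Q where "Q = (\<lambda>n. \<Sum>j<J. rep_product t (Suc j) $ n)"
  have Q0: "Q 0 = 0" unfolding Q_def by (intro sum.neutral ballI, subst rep_product_Suc_nth) simp
  \<comment> \<open>From the second product on, the largest part is at least
    \<open>t + 1 \<ge> 3\<close>, so monotonicity allows a shift by 3. The first product contributes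
    1 for \<open>n \<ge> 1\<close>; for \<open>n > 3\<close> this cancels against the same summand
    of \<open>Q (n - 3)\<close>, which is absent from one of the two shifted sums.\<close>
  have step: "Q n \<le> 2 * Q (n - 3) + of_bool (n \<le> 3)" for n
  proof (cases J)
    case (Suc K)
    have "rep_product t (Suc (Suc j)) $ n \<le> rep_product t (Suc j) $ (n - 3) + rep_product t (Suc (Suc j)) $ (n - 3)" for j
    proof (cases "n < repunit t (Suc (Suc j))")
      case False
      have "2 * 1 \<le> t * (t * repunit t j + 1)" using t by (intro mult_le_mono) auto
      then have "n - repunit t (Suc (Suc j)) \<le> n - 3" by (intro diff_le_mono2) simp
      then show ?thesis
        using False by (subst rep_product_Suc_nth) (auto intro!: add_mono rep_product_Suc_mono simp del: rep_product.simps repunit.simps)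
    qed (subst rep_product_Suc_nth, simp add: rep_product_nonneg del: rep_product.simps repunit.simps)
    then have "(\<Sum>j<K. rep_product t (Suc (Suc j)) $ n)
        \<le> (\<Sum>j<K. rep_product t (Suc j) $ (n - 3)) + (\<Sum>j<K. rep_product t (Suc (Suc j)) $ (n - 3))"
      unfolding sum.distrib[symmetric] by (intro sum_mono)
    also have "(\<Sum>j<K. rep_product t (Suc j) $ (n - 3)) \<le> Q (n - 3)"
      unfolding Q_def Suc by (simp add: rep_product_nonneg del: rep_product.simps)
    also have "(\<Sum>j<K. rep_product t (Suc (Suc j)) $ (n - 3)) = Q (n - 3) - rep_product t (Suc 0) $ (n - 3)"
      unfolding Q_def Suc by (simp add: sum.lessThan_Suc_shift del: rep_product.simps sum.lessThan_Suc)
    finally have "(\<Sum>j<K. rep_product t (Suc (Suc j)) $ n) \<le> 2 * Q (n - 3) - rep_product t (Suc 0) $ (n - 3)"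
      by simp
    moreover have "Q n = rep_product t (Suc 0) $ n + (\<Sum>j<K. rep_product t (Suc (Suc j)) $ n)"
      unfolding Q_def Suc by (rule sum.lessThan_Suc_shift)
    ultimately show ?thesis by (cases "n \<le> 3") (auto simp: rep_product_1_nth not_le Suc_le_eq simp del: rep_product.simps split: if_splits)
  qed (simp add: Q_def)
  have "Q n \<le> int (g_t t (n + 1))" for n
  proof (induction n rule: less_induct)
    case (less n)
    show ?case
    proof (cases "n \<le> 3")
      case True
      then have "Q n \<le> 1" using step[of n] Q0 by simp
      moreover have "g_t t (n + 1) \<ge> 1" using g_t_mono[OF t, of 0 "n + 1"] by (simp add: g_t_0 t)
      ultimately show ?thesis by linarith
    next
      case False
      have "Q n \<le> 2 * Q (n - 3)" using step[of n] False by simp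
      also have "\<dots> \<le> 2 * int (g_t t (n - 3 + 1))" using less[of "n - 3"] False by simp
      also have "\<dots> \<le> int (g_t t (n + 1))"
        using g_t_doubling[OF t, of "n - 3 + 1"] False by simp
      finally show ?thesis .
    qed
  qed
  moreover have "(\<Sum>j\<le>J. rep_product t j $ n) = of_bool (n = 0) + Q n"
    by (simp add: Q_def lessThan_Suc_atMost[symmetric] sum.lessThan_Suc_shift del: rep_product.simps(2) sum.lessThan_Suc)
  moreover have "g_t t 1 \<ge> 1" using g_t_mono[OF t, of 0 1] by (simp add: g_t_0 t)
  ultimately show ?thesis using Q0 by (cases "n = 0") auto
qed

text \<open>A representation of \<open>n < N\<close> by \<open>j\<close> parts is determined by
  \<open>j\<close> multiplicities below \<open>N\<close>. For logarithmic \<open>J\<close> this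
  bound has only \<open>O((log N)^2)\<close> bits.\<close>

lemma sum_product_le_power:
  assumes n: "n < N" and N: "N \<ge> 2"
  shows "(\<Sum>j\<le>J. rep_product t j $ n) \<le> int N ^ Suc J"
proof -
  have bound: "rep_product t j $ n \<le> int N ^ j" if "n < N" for j n
    using that
  proof (induction j arbitrary: n)
    case (Suc j)
    \<comment> \<open>The factor \<open>n\<close> in place of \<open>N\<close> makes the inner
      induction work: the removed part is at least 1, which pays for one more summand
      \<open>N ^ j\<close>.\<close>
    have "rep_product t (Suc j) $ n \<le> int n * int N ^ j" if "n < N" for n
      using that
    proof (induction n rule: less_induct)
      case (less n)
      show ?case
      proof (cases "n < repunit t (Suc j)")
        case False
        let ?k = "n - repunit t (Suc j)"
        have k: "?k < n" using False by simp
        have "rep_product t j $ ?k + rep_product t (Suc j) $ ?k \<le> int N ^ j + int ?k * int N ^ j"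
          using Suc.IH[of ?k] less.IH[OF k] less.prems k by linarith
        also have "\<dots> = int (Suc ?k) * int N ^ j" by (simp add: algebra_simps)
        also have "\<dots> \<le> int n * int N ^ j" using k by (intro mult_right_mono) auto
        finally show ?thesis using False by (subst rep_product_Suc_nth) simp
      qed (subst rep_product_Suc_nth, simp)
    qed
    from this[OF Suc.prems] have "rep_product t (Suc j) $ n \<le> int n * int N ^ j" .
    also have "\<dots> \<le> int N * int N ^ j" using Suc.prems by (intro mult_right_mono) auto
    finally show ?case by simp
  qed simp
  have "(\<Sum>j\<le>J. rep_product t j $ n) \<le> (\<Sum>j\<le>J. int N ^ j)" by (intro sum_mono bound n)
  also have "\<dots> \<le> int N ^ Suc J"
  proof (induction J)
    case (Suc J)
    have "2 * int N ^ Suc J \<le> int N * int N ^ Suc J" using N by (intro mult_right_mono) auto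
    then show ?case using Suc by simp
  qed (use N in simp)
  finally show ?thesis .
qed

text \<open>A common bound for all series occurring except the final quotient. The alternative
  \<open>\<le> 1\<close> directly covers the explicitly written series, with coefficients 0, 1 and
  -1.\<close>

definition bounded_coeffs :: "nat \<Rightarrow> nat \<Rightarrow> nat \<Rightarrow> int fps \<Rightarrow> bool" where
  "bounded_coeffs t J N h \<longleftrightarrow> (\<forall>n<N. \<bar>h $ n\<bar> \<le> (\<Sum>j\<le>J. rep_product t j $ n) \<or> \<bar>h $ n\<bar> \<le> 1)"

lemma bounded_coeffs_cutoff [simp]: "bounded_coeffs t J N (fps_cutoff N h) \<longleftrightarrow> bounded_coeffs t J N h"
  by (simp add: bounded_coeffs_def)

lemma abs_signed_product_nth: "\<bar>signed_product t j $ n\<bar> = rep_product t j $ n"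
proof -
  have "signed_product t j $ n = (- 1) ^ j * rep_product t j $ n"
    unfolding signed_product_eq by (cases "even j") auto
  then show ?thesis by (simp add: abs_mult power_abs rep_product_nonneg)
qed

text \<open>For \<open>j > 0\<close> the coefficients are monotone, so shifting them to the right
  only decreases them; for \<open>j = 0\<close> the shift is by 0.\<close>

lemma shifted_product_le: "(fps_X ^ repunit t j * rep_product t j) $ n \<le> rep_product t j $ n"
  by (cases j) (auto simp: fps_X_power_mult_nth rep_product_nonneg intro!: rep_product_Suc_mono
      simp del: repunit.simps(2) rep_product.simps(2))

lemma abs_shifted_signed_product_le: "\<bar>(fps_X ^ repunit t j * signed_product t j) $ n\<bar> \<le> rep_product t j $ n"
  using shifted_product_le[of t j n]
  by (auto simp: fps_X_power_mult_nth abs_signed_product_nth rep_product_nonneg split: if_splits)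

lemma bounded_products:
  assumes "j \<le> J"
  shows "bounded_coeffs t J N (signed_product t j)"
    "bounded_coeffs t J N (fps_X ^ repunit t j * signed_product t j)"
    "bounded_coeffs t J N (denominator t j)"
    "bounded_coeffs t J N (numerator t j)"
    "bounded_coeffs t J N (- multiples s)"
    "bounded_coeffs t J N (fps_X ^ i * - multiples s)"
proof -
  have le: "rep_product t j $ n \<le> (\<Sum>j\<le>J. rep_product t j $ n)" for n
    using assms by (intro member_le_sum) (auto simp: rep_product_nonneg)
  have sub: "(\<Sum>j\<le>j. rep_product t j $ n) \<le> (\<Sum>j\<le>J. rep_product t j $ n)" for n
    using assms by (intro sum_mono2) (auto simp: rep_product_nonneg)
  show "bounded_coeffs t J N (signed_product t j)"
    using le by (simp add: bounded_coeffs_def abs_signed_product_nth)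
  show "bounded_coeffs t J N (fps_X ^ repunit t j * signed_product t j)"
    unfolding bounded_coeffs_def using order_trans[OF abs_shifted_signed_product_le le] by blast
  have "\<bar>denominator t j $ n\<bar> \<le> (\<Sum>j\<le>j. rep_product t j $ n)" for n
    unfolding denominator_def fps_sum_nth abs_signed_product_nth[symmetric] by (rule sum_abs)
  then show "bounded_coeffs t J N (denominator t j)"
    unfolding bounded_coeffs_def using order_trans[OF _ sub] by blast
  have "\<bar>numerator t j $ n\<bar> \<le> (\<Sum>j\<le>j. rep_product t j $ n)" for n
    unfolding numerator_def fps_sum_nth
    by (rule order_trans[OF sum_abs sum_mono[OF abs_shifted_signed_product_le]])
  then show "bounded_coeffs t J N (numerator t j)"
    unfolding bounded_coeffs_def using order_trans[OF _ sub] by blast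
  show "bounded_coeffs t J N (- multiples s)"
    by (simp add: bounded_coeffs_def multiples_def)
  show "bounded_coeffs t J N (fps_X ^ i * - multiples s)"
    by (simp add: bounded_coeffs_def multiples_def fps_X_power_mult_nth)
qed

section \<open>From coefficient bounds to bit sizes\<close>

lemma bit_size_mono: "\<bar>c\<bar> \<le> \<bar>d\<bar> \<Longrightarrow> bit_size c \<le> bit_size d"
  unfolding bit_size_def by (intro floorlog_mono) auto

lemma bit_size_of_nat: "n \<ge> 1 \<Longrightarrow> bit_size (int n) = nat \<lfloor>log 2 (real n)\<rfloor> + 1"
  by (simp add: bit_size_def floorlog_def)

lemma bounded_coeffs_within_g_t:
  assumes t: "t \<ge> 2" and h: "bounded_coeffs t J N h"
  shows "coeffs_within N (nat \<lfloor>log 2 (real (g_t t N))\<rfloor> + 1) h"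
proof -
  have g: "g_t t N \<ge> 1" using g_t_mono[OF t, of 0 N] by (simp add: g_t_0 t)
  have "bit_size (h $ n) \<le> bit_size (int (g_t t N))" if n: "n < N" for n
  proof (rule bit_size_mono)
    have "g_t t (n + 1) \<le> g_t t N" using g_t_mono[OF t] n by simp
    then show "\<bar>h $ n\<bar> \<le> \<bar>int (g_t t N)\<bar>"
      using h n g sum_product_le_g_t[OF t, of n J] unfolding bounded_coeffs_def by fastforce
  qed
  then show ?thesis using g by (simp add: coeffs_within_def bit_size_of_nat)
qed

text \<open>\<open>N ^ (J + 1)\<close> is less than 2 to the power
  \<open>(J + 1) * bit_size (int N)\<close>. This is the bit size at which the operations enter the
  cost model.\<close>

lemma bounded_coeffs_within_power:
  assumes N: "N \<ge> 2" and h: "bounded_coeffs t J N h"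
  shows "coeffs_within N ((J + 1) * bit_size (int N)) h"
proof -
  let ?b = "bit_size (int N)"
  have Nb: "N < 2 ^ ?b" unfolding bit_size_def using floorlog_bounds[of N 2] N by simp
  have "bit_size (h $ n) \<le> (J + 1) * ?b" if n: "n < N" for n
  proof -
    have "int N ^ Suc J \<ge> 1" using N by (intro one_le_power) auto
    then have "\<bar>h $ n\<bar> \<le> int N ^ Suc J"
      using h n sum_product_le_power[OF n N, where t = t and J = J] unfolding bounded_coeffs_def by fastforce
    also have "\<dots> < (2 ^ ?b) ^ Suc J" using Nb by (intro power_strict_mono) (auto simp: nat_less_real_le)
    finally have "nat \<bar>h $ n\<bar> < 2 ^ ((J + 1) * ?b)"
      by (simp add: power_mult[symmetric] mult.commute power_add nat_less_iff)
    then show ?thesis unfolding bit_size_def by (intro floorlog_leI) auto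
  qed
  then show ?thesis by (simp add: coeffs_within_def)
qed

subsection \<open>The program\<close>

text \<open>One pass from \<open>j\<close> to \<open>Suc j\<close>: the new exponent, the new factor
  of \<open>signed_product\<close> with its sign in the literal -1, the product, and then the new
  summands of denominator and numerator.\<close>

definition loop_body :: prog where
  "loop_body =
    Seq (Compute 1 IMul 1 2) (Seq (Compute 1 IAdd 1 3)
    (Seq (Write 3 (- 1) 1) (Seq (Shift 3 1 3) (Seq (Series 2 Mul 2 3)
    (Seq (Series 1 Add 1 2) (Seq (Shift 3 1 2) (Series 0 Add 0 3)))))))"

text \<open>
  Index registers: 1 holds the exponent \<open>repunit t j\<close>, 2 holds \<open>t\<close>, 3 holds 1, and 4 a bound
  chosen such that the loop stops before the exponent exceeds \<open>N\<close>; 5 is never written and holds 0.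
  Series registers: 0 numerator, 1 denominator, 2 signed product, 3 auxiliary.
\<close>

definition g_t_prog :: "nat \<Rightarrow> prog" where
  "g_t_prog t =
    Seq (Literal 2 t) (Seq (Literal 3 1) (Seq (Compute 4 ISub 0 3) (Seq (Compute 4 IDiv 4 2)
    (Seq (Compute 4 IAdd 4 3) (Seq (Write 0 1 5) (Seq (Write 1 1 5) (Seq (Write 2 1 5)
    (Seq (While_Less 1 4 loop_body) (Series 0 Div 0 1)))))))))"

text \<open>Admissibility is restricted to \<open>t \<le> N\<close>, since a smaller
  \<open>N\<close> can have fewer binary digits than the literal \<open>t\<close>.\<close>

definition op_within :: "nat \<Rightarrow> nat \<Rightarrow> nat \<Rightarrow> operation \<Rightarrow> bool" where
  "op_within t N J p \<longleftrightarrow> arith_within N (nat \<lfloor>log 2 (real (g_t t N))\<rfloor> + 1) p \<and>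
     (t \<le> N \<longrightarrow> admissible N ((J + 1) * bit_size (int N)) p)"

lemma op_within_Arith:
  assumes "t \<ge> 2" "bounded_coeffs t J N a" "bounded_coeffs t J N b"
    "bounded_coeffs t J N (series_result N p a b)" "series_defined p b"
  shows "op_within t N J (Arith p a b)"
  using assms bounded_coeffs_within_g_t[OF assms(1)] bounded_coeffs_within_power[of N t J]
  by (simp add: op_within_def del: series_result.simps series_defined.simps)

lemma op_within_Other_Series:
  assumes "t \<ge> 2" "bounded_coeffs t J N h"
  shows "op_within t N J (Other_Series h)"
  using assms bounded_coeffs_within_power[of N t J h] by (simp add: op_within_def)

lemma op_within_Index:
  assumes "t \<ge> 2" "t \<le> N \<Longrightarrow> \<forall>n\<in>set ns. n \<le> N"
  shows "op_within t N J (Index ns)"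
  using assms bit_size_of_nat[of N] bit_size_mono[of "int _" "int N"]
  by (auto simp: op_within_def indices_within_def)

definition ops_within :: "nat \<Rightarrow> nat \<Rightarrow> nat \<Rightarrow> operation list \<Rightarrow> bool" where
  "ops_within t N J tr \<longleftrightarrow> (\<forall>p\<in>set tr. op_within t N J p)"

lemma ops_within_simps [simp]:
  "ops_within t N J []"
  "ops_within t N J (p # tr) \<longleftrightarrow> op_within t N J p \<and> ops_within t N J tr"
  "ops_within t N J (tr @ tr') \<longleftrightarrow> ops_within t N J tr \<and> ops_within t N J tr'"
  by (auto simp: ops_within_def)

lemma num_ops_simps [simp]:
  "num_ops X [] = 0"
  "num_ops X (p # tr) = of_bool (symbol_of p = X) + num_ops X tr"
  "num_ops X (tr @ tr') = num_ops X tr + num_ops X tr'"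
  by (simp_all add: num_ops_def)

section \<open>Correctness of the program and its operation counts\<close>

lemma fps_cutoff_mult: "fps_cutoff N (fps_cutoff N a * fps_cutoff N b) = fps_cutoff N (a * b :: int fps)"
  by (rule fps_ext) (auto simp: fps_mult_nth intro!: sum.cong)

lemma fps_cutoff_mult_right: "fps_cutoff N (a * fps_cutoff N b) = fps_cutoff N (a * b :: int fps)"
  by (rule fps_ext) (auto simp: fps_mult_nth intro!: sum.cong)

lemma fps_cutoff_add_cutoff: "fps_cutoff N (fps_cutoff N a + fps_cutoff N b) = fps_cutoff N (a + b :: int fps)"
  by (rule fps_ext) auto

definition loop_inv :: "nat \<Rightarrow> nat \<Rightarrow> nat \<Rightarrow> state \<Rightarrow> bool" where
  "loop_inv t N j s \<longleftrightarrow>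
     fst s 0 = fps_cutoff N (numerator t j) \<and>
     fst s 1 = fps_cutoff N (denominator t j) \<and>
     fst s 2 = fps_cutoff N (signed_product t j) \<and>
     snd s 1 = repunit t j \<and> snd s 2 = t \<and> snd s 3 = 1 \<and> snd s 4 = (N - 1) div t + 1"

lemma numerator_Suc:
  "numerator t (Suc j) = numerator t j + fps_X ^ repunit t (Suc j) * signed_product t (Suc j)"
  by (simp add: numerator_def)

lemma denominator_Suc: "denominator t (Suc j) = denominator t j + signed_product t (Suc j)"
  by (simp add: denominator_def)

lemma repunit_mono: "t > 0 \<Longrightarrow> i \<le> j \<Longrightarrow> repunit t i \<le> repunit t j"
proof (rule lift_Suc_mono_le[of "repunit t"])
  show "repunit t n \<le> repunit t (Suc n)" if "t > 0" for n
    using that by (cases t) auto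
qed

lemma exec_loop_body:
  assumes t: "t \<ge> 2" and N: "N \<ge> 1" and j: "j < J" and J: "repunit t J \<le> N" and inv: "loop_inv t N j s"
  obtains tr s' where "exec N loop_body s tr s'" "loop_inv t N (Suc j) s'" "ops_within t N J tr"
    "num_ops A_op tr = 2" "num_ops M_op tr = 1" "num_ops D_op tr = 0"
    "num_ops S_op tr = 3" "num_ops O_op tr = 2"
proof -
  obtain P k where s: "s = (P, k)" by (cases s)
  define e where "e = repunit t (Suc j)"
  define k1 where "k1 = k(1 := repunit t j * t)"
  define k2 where "k2 = k1(1 := e)"
  define m where "m = fps_cutoff N (- multiples e)"
  define w where "w = fps_cutoff N (fps_X ^ e * - multiples e)"
  define p where "p = fps_cutoff N (signed_product t (Suc j))"
  define d where "d = fps_cutoff N (denominator t (Suc j))"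
  define x where "x = fps_cutoff N (fps_X ^ e * signed_product t (Suc j))"
  define u where "u = fps_cutoff N (numerator t (Suc j))"
  have k: "k 1 = repunit t j" "k 2 = t" "k 3 = 1" "k 4 = (N - 1) div t + 1"
    and P: "P 0 = fps_cutoff N (numerator t j)" "P 1 = fps_cutoff N (denominator t j)"
      "P 2 = fps_cutoff N (signed_product t j)"
    using inv by (auto simp: loop_inv_def s)
  note k = k[unfolded One_nat_def] and P = P[unfolded One_nat_def]
  have 1: "exec N (Compute 1 IMul 1 2) (P, k) [Index [k 1, k 2, repunit t j * t]] (P, k1)"
    unfolding k1_def by (rule exec.Compute) (simp add: k)
  have 2: "exec N (Compute 1 IAdd 1 3) (P, k1) [Index [k1 1, k1 3, e]] (P, k2)"
    unfolding k2_def by (rule exec.Compute) (simp add: k1_def k e_def mult.commute)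
  have 3: "exec N (Write 3 (- 1) 1) (P, k2) [Other_Series m] (P(3 := m), k2)"
  proof (rule exec.Write)
    show "m = fps_cutoff N (Abs_fps (\<lambda>n. if k2 1 dvd n then - 1 else 0))"
      unfolding m_def by (rule fps_ext) (simp add: multiples_def k2_def)
  qed
  have 4: "exec N (Shift 3 1 3) (P(3 := m), k2) [Other_Series w] (P(3 := w), k2)"
    using exec.Shift[of w N k2 1 "P(3 := m)" 3 3]
    by (simp add: w_def m_def k2_def fps_cutoff_mult_right)
  have 5: "exec N (Series 2 Mul 2 3) (P(3 := w), k2) [Arith Mul (P 2) w] (P(3 := w, 2 := p), k2)"
    using exec.Series[of Mul "P(3 := w)" 3 N 2 2 k2]
    by (simp add: P w_def p_def fps_cutoff_mult e_def del: repunit.simps)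
  have 6: "exec N (Series 1 Add 1 2) (P(3 := w, 2 := p), k2) [Arith Add (P 1) p] (P(3 := w, 2 := p, 1 := d), k2)"
    using exec.Series[of Add "P(3 := w, 2 := p)" 2 N 1 1 k2]
    by (simp add: P p_def d_def fps_cutoff_add_cutoff denominator_Suc del: repunit.simps signed_product.simps)
  have 7: "exec N (Shift 3 1 2) (P(3 := w, 2 := p, 1 := d), k2) [Other_Series x] (P(2 := p, 1 := d, 3 := x), k2)"
    using exec.Shift[of x N k2 1 "P(3 := w, 2 := p, 1 := d)" 2 3]
    by (simp add: p_def x_def k2_def fps_cutoff_mult_right fun_upd_twist)
  have 8: "exec N (Series 0 Add 0 3) (P(2 := p, 1 := d, 3 := x), k2) [Arith Add (P 0) x]
      (P(2 := p, 1 := d, 3 := x, 0 := u), k2)"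
    using exec.Series[of Add "P(2 := p, 1 := d, 3 := x)" 3 N 0 0 k2]
    by (simp add: P x_def u_def e_def fps_cutoff_add_cutoff numerator_Suc del: repunit.simps signed_product.simps)
  \<comment> \<open>As \<open>j < J\<close>, the exponents computed in this pass are at most
    \<open>repunit t J \<le> N\<close>.\<close>
  have e: "e \<le> N" "repunit t j * t \<le> N" "repunit t j \<le> N"
    using repunit_mono[of t "Suc j" J] repunit_mono[of t j J] j J t by (auto simp: e_def mult.commute)
  have mul: "series_result N Mul (P 2) w = p"
    by (simp add: P w_def p_def fps_cutoff_mult e_def del: repunit.simps)
  have add: "series_result N Add (P 1) p = d" "series_result N Add (P 0) x = u"
    by (simp_all add: P x_def u_def p_def d_def e_def fps_cutoff_add_cutoff numerator_Suc denominator_Suc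
        del: repunit.simps signed_product.simps)
  have b: "bounded_coeffs t J N m" "bounded_coeffs t J N w" "bounded_coeffs t J N p"
    "bounded_coeffs t J N d" "bounded_coeffs t J N x" "bounded_coeffs t J N u"
    "bounded_coeffs t J N (P 0)" "bounded_coeffs t J N (P 1)" "bounded_coeffs t J N (P 2)"
    using bounded_products[of j J t N] bounded_products[of "Suc j" J t N] j
    by (simp_all add: m_def w_def p_def d_def x_def u_def e_def P del: repunit.simps signed_product.simps)
  show ?thesis
  proof (rule that)
    show "exec N loop_body s ([Index [k 1, k 2, repunit t j * t]] @ [Index [k1 1, k1 3, e]] @
        [Other_Series m] @ [Other_Series w] @ [Arith Mul (P 2) w] @ [Arith Add (P 1) p] @
        [Other_Series x] @ [Arith Add (P 0) x]) (P(2 := p, 1 := d, 3 := x, 0 := u), k2)"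
      unfolding loop_body_def s by (rule 1 2 3 4 5 6 7 8 exec.Seq)+
    show "loop_inv t N (Suc j) (P(2 := p, 1 := d, 3 := x, 0 := u), k2)"
      using k by (simp add: loop_inv_def u_def d_def p_def k2_def k1_def e_def
          del: repunit.simps signed_product.simps)
    show "ops_within t N J ([Index [k 1, k 2, repunit t j * t]] @ [Index [k1 1, k1 3, e]] @
        [Other_Series m] @ [Other_Series w] @ [Arith Mul (P 2) w] @ [Arith Add (P 1) p] @
        [Other_Series x] @ [Arith Add (P 0) x])"
      using t N e b
      by (auto simp: k k1_def mul add[unfolded One_nat_def] simp del: series_result.simps
          intro!: op_within_Index op_within_Arith op_within_Other_Series)
  qed simp_all
qed

text \<open>The loop test says that the next exponent \<open>t * r + 1\<close> is at most
  \<open>N\<close>, but in a form that avoids computing this exponent first.\<close>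

lemma less_bound_iff: "t > 0 \<Longrightarrow> N \<ge> 1 \<Longrightarrow> r < (N - 1) div t + 1 \<longleftrightarrow> t * r + 1 \<le> (N :: nat)"
  by (auto simp: less_Suc_eq_le less_eq_div_iff_mult_less_eq mult.commute)

text \<open>By the choice of \<open>J\<close> the loop stops exactly at the exponent
  \<open>repunit t J\<close>. Each pass has two index computations and one comparison; the final
  failing comparison is the \<open>+ 1\<close>.\<close>

lemma exec_loop:
  assumes t: "t \<ge> 2" and N: "N \<ge> 1" and J: "repunit t J \<le> N" "N < repunit t (Suc J)"
    and "j \<le> J" "loop_inv t N j s"
  shows "\<exists>tr s'. exec N (While_Less 1 4 loop_body) s tr s' \<and> loop_inv t N J s' \<and> ops_within t N J tr \<and>
    num_ops A_op tr = 2 * (J - j) \<and> num_ops M_op tr = J - j \<and> num_ops D_op tr = 0 \<and>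
    num_ops S_op tr = 3 * (J - j) \<and> num_ops O_op tr = 3 * (J - j) + 1"
  using assms(5,6)
proof (induction j arbitrary: s rule: inc_induct)
  case base
  obtain P k where s: "s = (P, k)" by (cases s)
  have "k 1 = repunit t J" "k 4 = (N - 1) div t + 1"
    using base by (auto simp: loop_inv_def s)
  note k = this[unfolded One_nat_def]
  have "\<not> t * repunit t J + 1 \<le> N" using J(2) by simp
  then have "\<not> k 1 < k 4"
    unfolding One_nat_def k using less_bound_iff[of t N "repunit t J"] t N by simp
  then have "exec N (While_Less 1 4 loop_body) s [Index [k 1, k 4]] s"
    unfolding s by (rule exec.While_False)
  moreover have "(N - 1) div t + 1 \<le> N" using N div_le_dividend[of "N - 1" t] by linarith
  then have "ops_within t N J [Index [k 1, k 4]]"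
    using t J by (auto simp: k intro!: op_within_Index)
  ultimately show ?case
    using base by (intro exI[of _ "[Index [k 1, k 4]]"] exI[of _ s]) simp
next
  case (step j)
  obtain P k where s: "s = (P, k)" by (cases s)
  have "k 1 = repunit t j" "k 4 = (N - 1) div t + 1"
    using step.prems by (auto simp: loop_inv_def s)
  note k = this[unfolded One_nat_def]
  have le: "repunit t (Suc j) \<le> N" "repunit t j \<le> N"
    using repunit_mono[of t "Suc j" J] repunit_mono[of t j J] step.hyps J t by linarith+
  then have lt: "k 1 < k 4"
    unfolding One_nat_def k using less_bound_iff[of t N "repunit t j"] t N by simp
  obtain tr1 s1 where 1: "exec N loop_body s tr1 s1" "loop_inv t N (Suc j) s1" "ops_within t N J tr1"
    "num_ops A_op tr1 = 2" "num_ops M_op tr1 = 1" "num_ops D_op tr1 = 0"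
    "num_ops S_op tr1 = 3" "num_ops O_op tr1 = 2"
    using exec_loop_body[OF t N step.hyps(2) J(1) step.prems] by blast
  obtain tr2 s2 where 2: "exec N (While_Less 1 4 loop_body) s1 tr2 s2" "loop_inv t N J s2"
    "ops_within t N J tr2" "num_ops A_op tr2 = 2 * (J - Suc j)" "num_ops M_op tr2 = J - Suc j"
    "num_ops D_op tr2 = 0" "num_ops S_op tr2 = 3 * (J - Suc j)" "num_ops O_op tr2 = 3 * (J - Suc j) + 1"
    using step.IH[OF 1(2)] by blast
  have "exec N (While_Less 1 4 loop_body) s (Index [k 1, k 4] # tr1 @ tr2) s2"
    unfolding s by (rule exec.While_True[OF lt _ 2(1)]) (use 1(1) s in simp)
  moreover have "(N - 1) div t + 1 \<le> N" using N div_le_dividend[of "N - 1" t] by linarith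
  then have "op_within t N J (Index [k 1, k 4])"
    using t le by (intro op_within_Index) (auto simp: k)
  ultimately show ?case
    using 1 2 step.hyps
    by (intro exI[of _ "Index [k 1, k 4] # tr1 @ tr2"] exI[of _ s2]) auto
qed

lemma Div_defined: "N \<ge> 1 \<Longrightarrow> series_defined Div (fps_cutoff N (denominator t J))"
  by (simp add: denominator_0)

text \<open>The setup has two literals, three index computations and three writes. With the last
  comparison of the loop this gives the additive constants 6 and 3.\<close>

lemma exec_g_t_prog:
  assumes t: "t \<ge> 2" and N: "N \<ge> 1" and J: "repunit t J \<le> N" "N < repunit t (Suc J)"
  shows "\<exists>tr s. exec N (g_t_prog t) (init_state N) tr s \<and> (\<forall>n<N. output_coeff s n = int (g_t t n)) \<and>
    ops_within t N J tr \<and>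
    num_ops A_op tr = 2 * J \<and> num_ops M_op tr = J \<and> num_ops D_op tr = 1 \<and>
    num_ops S_op tr = 3 * J + 3 \<and> num_ops O_op tr = 3 * J + 6"
proof -
  define k0 k1 k2 k3 k4 k5 :: "nat \<Rightarrow> nat"
    where "k0 = (\<lambda>_. 0)(0 := N)" and "k1 = k0(2 := t)" and "k2 = k1(3 := 1)"
      and "k3 = k2(4 := N - 1)" and "k4 = k3(4 := (N - 1) div t)"
      and "k5 = k4(4 := (N - 1) div t + 1)"
  note k = k0_def k1_def k2_def k3_def k4_def k5_def
  define P0 P1 P2 P3 :: "nat \<Rightarrow> int fps"
    where "P0 = (\<lambda>_. 0)" and "P1 = P0(0 := fps_cutoff N 1)" and "P2 = P1(1 := fps_cutoff N 1)"
      and "P3 = P2(2 := fps_cutoff N 1)"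
  note P = P0_def P1_def P2_def P3_def
  \<comment> \<open>Index register 5 holds 0, and 0 divides only 0, so \<open>Write\<close> produces
    the constant series 1.\<close>
  have one: "fps_cutoff N 1 = fps_cutoff N (Abs_fps (\<lambda>n. if k5 5 dvd n then 1 else 0 :: int))"
    by (rule fps_ext) (simp add: k)
  have 1: "exec N (Literal 2 t) (init_state N) [Index [t]] (P0, k1)"
    unfolding init_state_def k0_def[symmetric] P0_def[symmetric] k1_def by (rule exec.Literal)
  have 2: "exec N (Literal 3 1) (P0, k1) [Index [1]] (P0, k2)"
    unfolding k2_def by (rule exec.Literal)
  have 3: "exec N (Compute 4 ISub 0 3) (P0, k2) [Index [k2 0, k2 3, N - 1]] (P0, k3)"
    unfolding k3_def by (rule exec.Compute) (simp add: k)
  have 4: "exec N (Compute 4 IDiv 4 2) (P0, k3) [Index [k3 4, k3 2, (N - 1) div t]] (P0, k4)"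
    unfolding k4_def by (rule exec.Compute) (simp add: k)
  have 5: "exec N (Compute 4 IAdd 4 3) (P0, k4) [Index [k4 4, k4 3, (N - 1) div t + 1]] (P0, k5)"
    unfolding k5_def by (rule exec.Compute) (simp add: k)
  have 6: "exec N (Write 0 1 5) (P0, k5) [Other_Series (fps_cutoff N 1)] (P1, k5)"
    unfolding P1_def by (rule exec.Write) (rule one)
  have 7: "exec N (Write 1 1 5) (P1, k5) [Other_Series (fps_cutoff N 1)] (P2, k5)"
    unfolding P2_def by (rule exec.Write) (rule one)
  have 8: "exec N (Write 2 1 5) (P2, k5) [Other_Series (fps_cutoff N 1)] (P3, k5)"
    unfolding P3_def by (rule exec.Write) (rule one)
  have "loop_inv t N 0 (P3, k5)"
    by (simp add: loop_inv_def P k numerator_def denominator_def)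
  from exec_loop[OF t N J le0 this] obtain tr P4 k6 where 9:
    "exec N (While_Less 1 4 loop_body) (P3, k5) tr (P4, k6)" "loop_inv t N J (P4, k6)"
    "ops_within t N J tr" "num_ops A_op tr = 2 * J" "num_ops M_op tr = J" "num_ops D_op tr = 0"
    "num_ops S_op tr = 3 * J" "num_ops O_op tr = 3 * J + 1"
    by auto
  have P4: "P4 0 = fps_cutoff N (numerator t J)" "P4 1 = fps_cutoff N (denominator t J)"
    using 9(2) by (auto simp: loop_inv_def)
  define G where "G = series_result N Div (P4 0) (P4 1)"
  have G: "G $ n = int (g_t t n)" if "n < N" for n
    unfolding G_def P4 using generating_function_quotient[OF t _ that] J(2) by (simp del: series_result.simps)
  have 10: "exec N (Series 0 Div 0 1) (P4, k6) [Arith Div (P4 0) (P4 1)] (P4(0 := G), k6)"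
    unfolding G_def by (rule exec.Series) (use Div_defined[OF N] P4 in metis)
  let ?tr = "[Index [t]] @ [Index [1]] @ [Index [k2 0, k2 3, N - 1]] @ [Index [k3 4, k3 2, (N - 1) div t]] @
    [Index [k4 4, k4 3, (N - 1) div t + 1]] @ [Other_Series (fps_cutoff N 1)] @
    [Other_Series (fps_cutoff N 1)] @ [Other_Series (fps_cutoff N 1)] @ tr @ [Arith Div (P4 0) (P4 1)]"
  have "exec N (g_t_prog t) (init_state N) ?tr (P4(0 := G), k6)"
    unfolding g_t_prog_def by (rule 1 2 3 4 5 6 7 8 9 10 exec.Seq)+
  moreover have "output_coeff (P4(0 := G), k6) n = int (g_t t n)" if "n < N" for n
    using G[OF that] by (simp add: output_coeff_def)
  \<comment> \<open>The coefficients of the quotient are values of \<open>g_t\<close> below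
    \<open>N\<close> and bounded by monotonicity. Admissibility concerns the operands only, so the
    small bit size applies.\<close>
  moreover have "op_within t N J (Arith Div (P4 0) (P4 1))"
  proof -
    have b: "bounded_coeffs t J N (P4 0)" "bounded_coeffs t J N (P4 1)"
      unfolding P4 bounded_coeffs_cutoff by (rule bounded_products; simp)+
    have g: "g_t t N \<ge> 1" using g_t_mono[OF t, of 0 N] by (simp add: g_t_0 t)
    have "bit_size (G $ n) \<le> bit_size (int (g_t t N))" if "n < N" for n
      using G[OF that] g_t_mono[OF t, of n N] that by (intro bit_size_mono) simp
    then have "coeffs_within N (nat \<lfloor>log 2 (real (g_t t N))\<rfloor> + 1) G"
      using g by (simp add: coeffs_within_def bit_size_of_nat)
    moreover have "series_defined Div (P4 1)" using Div_defined[OF N] P4 by metis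
    ultimately show ?thesis
      using b t bounded_coeffs_within_g_t[OF t] bounded_coeffs_within_power[of N t J]
      by (simp add: op_within_def G_def[symmetric] del: series_result.simps series_defined.simps One_nat_def)
  qed
  moreover have "bounded_coeffs t J N 1" by (simp add: bounded_coeffs_def)
  moreover have "(N - 1) div t + 1 \<le> N" "(N - 1) div t \<le> N"
    using N div_le_dividend[of "N - 1" t] by linarith+
  ultimately show ?thesis
    using 9 t N
    by (intro exI[of _ ?tr] exI[of _ "(P4(0 := G), k6)"])
       (auto simp: k intro!: op_within_Index op_within_Other_Series)
qed

section \<open>Number of passes\<close>

lemma repunit_upper: "t \<ge> 2 \<Longrightarrow> repunit t j \<le> t ^ j - 1"
proof (induction j)
  case (Suc j)
  have "repunit t j + 1 \<le> t ^ j" using Suc one_le_power[of t j] by linarith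
  then have "t * (repunit t j + 1) \<le> t * t ^ j" by (rule mult_le_mono2)
  moreover have "repunit t (Suc j) + 1 \<le> t * (repunit t j + 1)" using Suc.prems by (simp add: algebra_simps)
  ultimately show ?case by simp
qed simp

lemma repunit_lower: "t ^ j \<le> repunit t (Suc j)"
proof (induction j)
  case (Suc j)
  have "t * t ^ j \<le> t * repunit t (Suc j)" using Suc by (rule mult_le_mono2)
  then show ?case by simp
qed simp

text \<open>From \<open>t ^ (J - 1) \<le> repunit t J \<le> N < repunit t (Suc J) < t ^ (J +
  1)\<close>, for \<open>J > 0\<close>, the logarithm lies between \<open>J - 1\<close> and
  \<open>J + 1\<close>.\<close>

lemma repunit_bracket:
  assumes t: "t \<ge> 2" and N: "N \<ge> 1"
  obtains J where "repunit t J \<le> N" "N < repunit t (Suc J)" "\<bar>real J - log (real t) (real N)\<bar> \<le> 1"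
proof -
  define K where "K = (LEAST K. N < repunit t K)"
  have "N < t ^ N" using t by (intro power_gt_expt) auto
  also have "\<dots> \<le> repunit t (Suc N)" by (rule repunit_lower)
  finally have K: "N < repunit t K" unfolding K_def by (rule LeastI)
  then obtain J where J: "K = Suc J" using N by (cases K) auto
  have J1: "repunit t J \<le> N"
    using not_less_Least[of J "\<lambda>K. N < repunit t K"] J unfolding K_def by (metis lessI not_le)
  have J2: "N < repunit t (Suc J)" using K J by simp
  have "N < t ^ Suc J" using J2 repunit_upper[OF t, of "Suc J"] by linarith
  then have "real N < real t ^ Suc J" by (metis of_nat_less_iff of_nat_power)
  then have "log t N < real (Suc J)" using t N by (simp add: log_less_iff powr_realpow del: of_nat_Suc)
  moreover have "real J - 1 \<le> log t N"
  proof (cases J)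
    case (Suc i)
    have "t ^ i \<le> N" using repunit_lower[of t i] J1 Suc by simp
    then have "real t ^ i \<le> real N" by (metis of_nat_le_iff of_nat_power)
    then have "real i \<le> log t N" using t N by (simp add: le_log_iff powr_realpow)
    then show ?thesis using Suc by simp
  qed (use t N in \<open>simp add: le_log_iff zero_le_log_cancel_iff order_trans[of _ 0]\<close>)
  ultimately have "\<bar>real J - log (real t) (real N)\<bar> \<le> 1" by simp
  with J1 J2 show ?thesis by (rule that)
qed

subsection \<open>Cost\<close>

lemma total_cost_le:
  fixes b :: "symbol \<Rightarrow> real"
  assumes "\<forall>p\<in>set tr. real (cost N p) \<le> b (symbol_of p)"
  shows "real (total_cost cost N tr) \<le> num_ops A_op tr * b A_op + num_ops M_op tr * b M_op +
    num_ops D_op tr * b D_op + num_ops S_op tr * b S_op + num_ops O_op tr * b O_op"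
  using assms
proof (induction tr)
  case (Cons p tr)
  then have "real (total_cost cost N tr) + real (cost N p) \<le>
    (num_ops A_op tr * b A_op + num_ops M_op tr * b M_op +
    num_ops D_op tr * b D_op + num_ops S_op tr * b S_op + num_ops O_op tr * b O_op) + b (symbol_of p)"
    by (intro add_mono) auto
  also have "\<dots> = num_ops A_op (p # tr) * b A_op + num_ops M_op (p # tr) * b M_op +
    num_ops D_op (p # tr) * b D_op + num_ops S_op (p # tr) * b S_op + num_ops O_op (p # tr) * b O_op"
    by (cases "symbol_of p") (simp_all add: algebra_simps)
  finally show ?case by (simp add: total_cost_def)
qed (simp add: total_cost_def)

text \<open>The bound is specialised to bit sizes up to \<open>N\<close> and made valid for all
  larger constants, so that the five symbols can share one constant.\<close>

lemma cost_bound_eventually: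
  assumes "cost_bound cost X B"
    and "\<forall>C C' N m. C \<le> C' \<and> N \<ge> 1 \<and> m \<ge> 2 \<longrightarrow> B C N m \<le> B C' N m"
  shows "\<exists>C0. \<forall>C\<ge>C0. \<forall>\<^sub>F N in sequentially. \<forall>m p.
    2 \<le> m \<and> real m \<le> real N \<and> symbol_of p = X \<and> admissible N m p \<longrightarrow> real (cost N p) \<le> B C N m"
proof -
  obtain C0 where C0: "\<forall>\<^sub>F N in sequentially. \<forall>m p.
    2 \<le> m \<and> real m \<le> 1 * real N \<and> symbol_of p = X \<and> admissible N m p \<longrightarrow> real (cost N p) \<le> B C0 N m"
    using assms(1) unfolding cost_bound_def by blast
  have "\<forall>\<^sub>F N in sequentially. \<forall>m p.
    2 \<le> m \<and> real m \<le> real N \<and> symbol_of p = X \<and> admissible N m p \<longrightarrow> real (cost N p) \<le> B C N m"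
    if "C \<ge> C0" for C
    using C0 eventually_ge_at_top[of 1]
    by eventually_elim (metis assms(2) that mult_1 order_trans)
  then show ?thesis by blast
qed

lemma log_star_pos: "x > 1 \<Longrightarrow> log_star x \<ge> 1"
  by (subst log_star.simps) simp

text \<open>As \<open>L \<ge> 1\<close>, the factor \<open>K * C\<close> is at most
  \<open>exp (K * C * L)\<close>, and \<open>2 * ln 2 \<ge> 1\<close> turns this into a power of 2
  that joins the exponent.\<close>

lemma powr_absorb_constant:
  assumes "K \<ge> 0" "C \<ge> 1" "L \<ge> 1" "X \<ge> 0"
  shows "K * C * (X * 2 powr (C * L)) \<le> X * 2 powr ((2 * K + 1) * C * (L :: real))"
proof -
  have ln2: "1 \<le> ln 2 * (2 :: real)" using ln_le_minus_one[of "1 / 2 :: real"] by (simp add: ln_div)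
  have "K * C * 1 \<le> K * C * L" using assms by (intro mult_left_mono) auto
  also have "K * C * L \<le> exp (K * C * L)" using exp_ge_add_one_self[of "K * C * L"] by linarith
  also have "\<dots> \<le> 2 powr (2 * K * C * L)"
  proof -
    have "K * C * L * 1 \<le> K * C * L * (ln 2 * 2)" using assms ln2 by (intro mult_left_mono) auto
    then show ?thesis by (simp add: powr_def algebra_simps)
  qed
  finally have "K * C \<le> 2 powr (2 * K * C * L)" by simp
  then have "K * C * (X * 2 powr (C * L)) \<le> 2 powr (2 * K * C * L) * (X * 2 powr (C * L))"
    using assms by (intro mult_right_mono) auto
  also have "\<dots> = X * 2 powr ((2 * K + 1) * C * L)"
    by (simp add: powr_add[symmetric] algebra_simps)
  finally show ?thesis .
qed

text \<open>The summands belong to A, M, D, S, O in this order, with \<open>j\<close> passes,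
  \<open>l = ln N\<close> and \<open>n = N\<close>. Their bounds add up to 8 + 4 + 1 + 12 + 15 =
  40.\<close>

lemma ring_cost_arith:
  fixes j l L C n E :: real
  assumes "j \<ge> 0" "j + 1 \<le> 4 * l" "l \<ge> 1" "C \<ge> 1" "n \<ge> 1" "E \<ge> 1"
  shows "2 * j * (C * n) + j * (n * l * E) + 1 * (n * l * E) + (3 * j + 3) * (C * n) + (3 * j + 6) * C
    \<le> 40 * C * (n * l ^ 2 * E)"
proof -
  define W where "W = n * l ^ 2 * E"
  have ll: "l \<le> l ^ 2" using assms self_le_power[of l 2] by simp
  have nl: "n * l * 1 \<le> n * l ^ 2 * E" using assms ll by (intro mult_mono) auto
  have "1 * l \<le> n * l" using assms by (intro mult_right_mono) auto
  then have l: "l \<le> W" using nl by (simp add: W_def)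
  have nl: "n * l \<le> W" using nl by (simp add: W_def)
  have nlE: "n * l * E \<le> W" unfolding W_def using assms ll by (intro mult_mono) auto
  have W: "W \<ge> 0" using l assms by linarith
  have "n * j \<le> n * (4 * l)" "n * (j + 1) \<le> n * (4 * l)"
    by (rule mult_left_mono; use assms in linarith)+
  then have 0: "n * j \<le> 4 * W" "n * (j + 1) \<le> 4 * W" using nl by linarith+
  have "C * (2 * (n * j)) \<le> C * (8 * W)" using 0 assms by (intro mult_left_mono) linarith+
  moreover have "j * (n * l * E) \<le> 4 * l * (n * l * E)" using assms by (intro mult_right_mono) auto
  then have "j * (n * l * E) \<le> 4 * W" by (simp add: W_def power2_eq_square algebra_simps)
  moreover have "C * (3 * (n * (j + 1))) \<le> C * (12 * W)" using 0 assms by (intro mult_left_mono) linarith+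
  moreover have "C * (3 * j + 6) \<le> C * (15 * W)" using l assms by (intro mult_left_mono) auto
  moreover have "1 * W \<le> C * W" using assms W by (intro mult_right_mono) auto
  ultimately show ?thesis using nlE unfolding W_def[symmetric] by (simp add: algebra_simps)
qed

text \<open>The division determines the order, with \<open>m\<close> of size \<open>l ^ 2\<close>.
  The multiplications have a fifth power of \<open>l\<close> but only one factor \<open>n\<close>,
  and \<open>l \<le> n\<close> trades one for the other.\<close>

lemma bit_cost_arith:
  fixes j l L C n E m :: real
  assumes "j \<ge> 0" "j + 1 \<le> 4 * l" "l \<ge> 1" "C \<ge> 1" "n \<ge> 1" "E \<ge> 1" "l \<le> n"
    "2 \<le> m" "m \<le> 16 * l ^ 2" "m \<le> n" "l = ln n"
  shows "2 * j * (C * (n * m)) + j * (n * l * E * (m * ln m)) + 1 * (n ^ 2 * m * l ^ 2 * E) +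
      (3 * j + 3) * (C * (n * m)) + (3 * j + 6) * (C * l ^ 2)
    \<le> 500 * C * (n ^ 2 * l ^ 4 * E)"
proof -
  define W where "W = n ^ 2 * l ^ 4 * E"
  have l34: "l ^ 3 \<le> l ^ 4" using assms by (intro power_increasing) auto
  have nn: "n \<le> n ^ 2" using assms self_le_power[of n 2] by simp
  have "n * l ^ 3 * 1 \<le> n ^ 2 * l ^ 4 * E" using assms nn l34 by (intro mult_mono) auto
  then have nl: "n * l ^ 3 \<le> W" by (simp add: W_def)
  have "1 * l ^ 3 \<le> n * l ^ 3" using assms by (intro mult_right_mono) auto
  then have l: "l ^ 3 \<le> W" using nl by linarith
  have W: "W \<ge> 1" using l assms one_le_power[of l 3] by linarith
  have "(j + 1) * (n * m) \<le> 4 * l * (n * (16 * l ^ 2))" using assms by (intro mult_mono) auto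
  also have "\<dots> = 64 * (n * l ^ 3)" by (simp add: power2_eq_square power3_eq_cube)
  finally have 1: "(j + 1) * (n * m) \<le> 64 * W" using nl by linarith
  have "0 \<le> n * m" using assms by auto
  then have 2: "j * (n * m) \<le> 64 * W" using 1 by (simp add: algebra_simps)
  have "ln m \<le> l" using assms by simp
  then have "m * ln m \<le> 16 * l ^ 2 * l" using assms by (intro mult_mono) auto
  then have "j * (n * l * E * (m * ln m)) \<le> 4 * l * (n * l * E * (16 * l ^ 2 * l))"
    using assms by (intro mult_mono) auto
  also have "\<dots> = 64 * (n * l * (l ^ 4 * E))" by (simp add: power2_eq_square power4_eq_xxxx)
  also have "n * l * (l ^ 4 * E) \<le> n * n * (l ^ 4 * E)" using assms by (intro mult_right_mono mult_left_mono) auto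
  finally have 3: "j * (n * l * E * (m * ln m)) \<le> 64 * W" by (simp add: W_def power2_eq_square mult.assoc)
  have "n ^ 2 * m * l ^ 2 * E \<le> n ^ 2 * (16 * l ^ 2) * l ^ 2 * E"
    using assms by (intro mult_right_mono mult_left_mono) auto
  also have "\<dots> = 16 * W" by (simp add: W_def power2_eq_square power4_eq_xxxx)
  finally have 4: "n ^ 2 * m * l ^ 2 * E \<le> 16 * W" .
  have "(3 * j + 6) * l ^ 2 \<le> (15 * l) * l ^ 2" using assms by (intro mult_right_mono) auto
  then have 5: "(3 * j + 6) * l ^ 2 \<le> 15 * W" using l by (simp add: power2_eq_square power3_eq_cube)
  define V where "V = C * W"
  define a where "a = C * (j * (n * m))"
  define b where "b = C * ((j + 1) * (n * m))"
  define c where "c = C * ((3 * j + 6) * l ^ 2)"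
  have "a \<le> C * (64 * W)" "b \<le> C * (64 * W)" "c \<le> C * (15 * W)"
    unfolding a_def b_def c_def using 1 2 5 assms by (intro mult_left_mono; linarith)+
  then have abc: "a \<le> 64 * V" "b \<le> 64 * V" "c \<le> 15 * V" by (simp_all add: V_def)
  have V: "W \<le> V" unfolding V_def using assms W by simp
  have "2 * j * (C * (n * m)) + j * (n * l * E * (m * ln m)) + 1 * (n ^ 2 * m * l ^ 2 * E) +
      (3 * j + 3) * (C * (n * m)) + (3 * j + 6) * (C * l ^ 2) =
      2 * a + j * (n * l * E * (m * ln m)) + n ^ 2 * m * l ^ 2 * E + 3 * b + c"
    by (simp add: a_def b_def c_def algebra_simps)
  also have "\<dots> \<le> 2 * (64 * V) + 64 * V + 16 * V + 3 * (64 * V) + 15 * V"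
    using abc V 3 4 W by (intro add_mono mult_left_mono) linarith+
  also have "\<dots> \<le> 500 * V" using V W by simp
  finally show ?thesis by (simp add: V_def W_def mult.assoc)
qed

text \<open>Since \<open>ln 2 \<ge> 1 / 2\<close>, both \<open>J N + 1\<close> and the bit size of
  \<open>N\<close> are at most \<open>4 * ln N\<close>; their product gives the factor 16.\<close>

lemma eventually_sizes:
  fixes t :: nat and J :: "nat \<Rightarrow> nat"
  assumes t: "t \<ge> 2" and J: "\<forall>N\<ge>1. \<bar>real (J N) - log (real t) (real N)\<bar> \<le> 1"
  shows "\<forall>\<^sub>F N in sequentially. t \<le> N \<and> 2 \<le> (J N + 1) * bit_size (int N) \<and>
    real ((J N + 1) * bit_size (int N)) \<le> 16 * ln (real N) ^ 2 \<and>
    real ((J N + 1) * bit_size (int N)) \<le> real N \<and>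
    real (J N) + 1 \<le> 4 * ln (real N) \<and> 1 \<le> ln (real N) \<and> ln (real N) \<le> real N \<and>
    1 \<le> log_star (real N)"
proof -
  have "\<forall>\<^sub>F N in sequentially. 16 * ln (real N) ^ 2 \<le> real N" by real_asymp
  moreover have "\<forall>\<^sub>F N in sequentially. 1 \<le> ln (real N)" by real_asymp
  ultimately show ?thesis using eventually_ge_at_top[of t] eventually_ge_at_top[of 2]
  proof eventually_elim
    case (elim N)
    let ?l = "ln (real N)"
    have ln2: "ln (2 :: real) \<ge> 1 / 2" using ln_le_minus_one[of "1 / 2 :: real"] by (simp add: ln_div)
    have "log 2 (real N) \<le> ?l / (1 / 2)"
      unfolding log_def using elim ln2 by (intro divide_left_mono) auto
    then have log2: "log 2 (real N) \<le> 2 * ?l" by simp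
    have "log (real t) (real N) \<le> log 2 (real N)"
      unfolding log_def using elim t by (intro divide_left_mono) auto
    then have J1: "real (J N) + 1 \<le> 4 * ?l" using J[rule_format, of N] log2 elim by linarith
    have b: "bit_size (int N) = nat \<lfloor>log 2 (real N)\<rfloor> + 1" using elim by (intro bit_size_of_nat) auto
    have "1 \<le> log 2 (real N)" using elim by (simp add: le_log_iff)
    then have b2: "2 \<le> bit_size (int N)" unfolding b by linarith
    have "real (bit_size (int N)) \<le> log 2 (real N) + 1"
      unfolding b using \<open>1 \<le> log 2 (real N)\<close> by linarith
    then have b4: "real (bit_size (int N)) \<le> 4 * ?l" using log2 elim by linarith
    have "(real (J N) + 1) * real (bit_size (int N)) \<le> (4 * ?l) * (4 * ?l)"
      using J1 b4 elim by (intro mult_mono) auto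
    then have m: "real ((J N + 1) * bit_size (int N)) \<le> 16 * ?l ^ 2"
      by (simp add: power2_eq_square algebra_simps)
    have "?l \<le> real N" using ln_le_minus_one[of "real N"] elim by linarith
    moreover have "2 \<le> (J N + 1) * bit_size (int N)" using b2 by simp
    moreover have "1 \<le> log_star (real N)" using elim by (intro log_star_pos) auto
    ultimately show ?case using m J1 elim by auto
  qed
qed

lemma
  fixes t :: nat and J :: "nat \<Rightarrow> nat" and trace :: "nat \<Rightarrow> operation list"
  assumes t: "t \<ge> 2" and J: "\<forall>N\<ge>1. \<bar>real (J N) - log (real t) (real N)\<bar> \<le> 1"
    and within: "\<forall>N\<ge>1. ops_within t N (J N) (trace N)"
    and ops: "\<forall>N\<ge>1. num_ops A_op (trace N) = 2 * J N"
      "\<forall>N\<ge>1. num_ops M_op (trace N) = J N"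
      "\<forall>N\<ge>1. num_ops D_op (trace N) = 1"
      "\<forall>N\<ge>1. num_ops S_op (trace N) = 3 * J N + 3"
      "\<forall>N\<ge>1. num_ops O_op (trace N) = 3 * J N + 6"
  shows total_ring_cost: "ring_cost_model cost \<Longrightarrow> \<exists>C::real. \<forall>\<^sub>F N in sequentially.
        real (total_cost cost N (trace N))
          \<le> real N * ln (real N) ^ 2 * 2 powr (C * real (log_star (real N)))"
    and total_bit_cost: "bit_cost_model cost \<Longrightarrow> \<exists>C::real. \<forall>\<^sub>F N in sequentially.
        real (total_cost cost N (trace N))
          \<le> real N ^ 2 * ln (real N) ^ 4 * 2 powr (C * real (log_star (real N)))"
proof -
  let ?m = "\<lambda>N. (J N + 1) * bit_size (int N)"
  \<comment> \<open>One constant serves all five symbols, and the common bit size is eventually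
    between 2 and \<open>N\<close>, as the cost bounds require.\<close>
  have collect: "\<exists>C\<ge>1. \<forall>\<^sub>F N in sequentially. \<forall>p\<in>set (trace N). real (cost N p) \<le> B (symbol_of p) C N (?m N)"
    if bound: "\<forall>X. cost_bound cost X (B X)"
      and mono: "\<forall>X C C' N m. C \<le> C' \<and> N \<ge> 1 \<and> m \<ge> 2 \<longrightarrow> B X C N m \<le> B X C' N m"
    for B :: "symbol \<Rightarrow> real \<Rightarrow> nat \<Rightarrow> nat \<Rightarrow> real"
  proof -
    have "\<exists>C0. \<forall>X. \<forall>C\<ge>C0 X. \<forall>\<^sub>F N in sequentially. \<forall>m p.
        2 \<le> m \<and> real m \<le> real N \<and> symbol_of p = X \<and> admissible N m p \<longrightarrow> real (cost N p) \<le> B X C N m"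
      by (intro choice allI cost_bound_eventually) (use bound mono in blast)+
    then obtain C0 where C0: "\<And>X C. C \<ge> C0 X \<Longrightarrow> \<forall>\<^sub>F N in sequentially. \<forall>m p.
        2 \<le> m \<and> real m \<le> real N \<and> symbol_of p = X \<and> admissible N m p \<longrightarrow> real (cost N p) \<le> B X C N m"
      by blast
    define C where "C = Max {1, C0 A_op, C0 M_op, C0 D_op, C0 S_op, C0 O_op}"
    have "1 \<le> C" "C0 A_op \<le> C" "C0 M_op \<le> C" "C0 D_op \<le> C" "C0 S_op \<le> C" "C0 O_op \<le> C"
      unfolding C_def by (simp_all add: Max_ge_iff)
    note C = this
    have "\<forall>\<^sub>F N in sequentially. \<forall>p\<in>set (trace N). real (cost N p) \<le> B (symbol_of p) C N (?m N)"
      using C0[OF C(2)] C0[OF C(3)] C0[OF C(4)] C0[OF C(5)] C0[OF C(6)]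
        eventually_sizes[OF t J] eventually_ge_at_top[of 1]
    proof eventually_elim
      case (elim N)
      show ?case
      proof
        fix p assume "p \<in> set (trace N)"
        then have "admissible N (?m N) p"
          using within[rule_format, of N] elim unfolding ops_within_def op_within_def by auto
        then show "real (cost N p) \<le> B (symbol_of p) C N (?m N)"
          using elim(1-6) by (cases "symbol_of p") metis+
      qed
    qed
    then show ?thesis using C(1) by blast
  qed
  show "\<exists>C::real. \<forall>\<^sub>F N in sequentially. real (total_cost cost N (trace N))
          \<le> real N * ln (real N) ^ 2 * 2 powr (C * real (log_star (real N)))"
    if cost: "ring_cost_model cost"
  proof -
    define B :: "symbol \<Rightarrow> real \<Rightarrow> nat \<Rightarrow> nat \<Rightarrow> real"
      where "B = (\<lambda>X C N m. case X of A_op \<Rightarrow> C * N | M_op \<Rightarrow> N * ln N * 2 powr (C * log_star N) |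
        D_op \<Rightarrow> N * ln N * 2 powr (C * log_star N) | S_op \<Rightarrow> C * N | O_op \<Rightarrow> C)"
    have "cost_bound cost X (B X)" for X
      using cost by (cases X) (simp_all add: B_def ring_cost_model_def)
    moreover have "B X C N m \<le> B X C' N m" if "C \<le> C'" "N \<ge> 1" for X C C' N m
      using that by (cases X) (auto simp: B_def intro!: mult_left_mono mult_right_mono)
    ultimately obtain C where C: "C \<ge> 1" "\<forall>\<^sub>F N in sequentially. \<forall>p\<in>set (trace N).
        real (cost N p) \<le> B (symbol_of p) C N (?m N)"
      using collect[of B] by (metis (no_types, lifting))
    \<comment> \<open>The constant in the exponent comes from \<open>powr_absorb_constant\<close>
      with \<open>K = 40\<close>; in the bit case \<open>K = 500\<close>.\<close>
    have "\<forall>\<^sub>F N in sequentially. real (total_cost cost N (trace N))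
          \<le> real N * ln (real N) ^ 2 * 2 powr ((2 * 40 + 1) * C * real (log_star (real N)))"
      using C(2) eventually_sizes[OF t J] eventually_ge_at_top[of 1]
    proof eventually_elim
      case (elim N)
      let ?E = "2 powr (C * real (log_star (real N)))"
      have L: "real (log_star (real N)) \<ge> 1" using elim by simp
      have E: "?E \<ge> 1" using C(1) by (intro ge_one_powr_ge_zero) auto
      have "real (total_cost cost N (trace N)) \<le> 2 * real (J N) * (C * real N) +
          real (J N) * (real N * ln N * ?E) + 1 * (real N * ln N * ?E) +
          (3 * real (J N) + 3) * (C * N) + (3 * real (J N) + 6) * C"
        using total_cost_le[where cost = cost and N = N and b = "\<lambda>X. B X C N (?m N)", OF elim(1)] elim by (simp add: ops B_def)
      also have "\<dots> \<le> 40 * C * (real N * ln N ^ 2 * ?E)"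
        using elim C(1) E by (intro ring_cost_arith) auto
      also have "\<dots> \<le> real N * ln (real N) ^ 2 * 2 powr ((2 * 40 + 1) * C * real (log_star (real N)))"
        using C(1) L by (intro powr_absorb_constant) auto
      finally show ?case .
    qed
    then show ?thesis by blast
  qed
  show "\<exists>C::real. \<forall>\<^sub>F N in sequentially. real (total_cost cost N (trace N))
          \<le> real N ^ 2 * ln (real N) ^ 4 * 2 powr (C * real (log_star (real N)))"
    if cost: "bit_cost_model cost"
  proof -
    define B :: "symbol \<Rightarrow> real \<Rightarrow> nat \<Rightarrow> nat \<Rightarrow> real"
      where "B = (\<lambda>X C N m. case X of A_op \<Rightarrow> C * (N * m) |
        M_op \<Rightarrow> N * ln N * 2 powr (C * log_star N) * (m * ln m) |
        D_op \<Rightarrow> N ^ 2 * m * ln N ^ 2 * 2 powr (C * log_star N) | S_op \<Rightarrow> C * (N * m) |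
        O_op \<Rightarrow> C * ln N ^ 2)"
    have "cost_bound cost X (B X)" for X
      using cost by (cases X) (simp_all add: B_def bit_cost_model_def)
    moreover have "B X C N m \<le> B X C' N m" if "C \<le> C'" "N \<ge> 1" "m \<ge> 2" for X C C' N m
      using that by (cases X) (auto simp: B_def intro!: mult_left_mono mult_right_mono)
    ultimately obtain C where C: "C \<ge> 1" "\<forall>\<^sub>F N in sequentially. \<forall>p\<in>set (trace N).
        real (cost N p) \<le> B (symbol_of p) C N (?m N)"
      using collect[of B] by (metis (no_types, lifting))
    have "\<forall>\<^sub>F N in sequentially. real (total_cost cost N (trace N))
          \<le> real N ^ 2 * ln (real N) ^ 4 * 2 powr ((2 * 500 + 1) * C * real (log_star (real N)))"
      using C(2) eventually_sizes[OF t J] eventually_ge_at_top[of 1]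
    proof eventually_elim
      case (elim N)
      let ?E = "2 powr (C * real (log_star (real N)))" and ?M = "real (?m N)"
      have L: "real (log_star (real N)) \<ge> 1" using elim by simp
      have E: "?E \<ge> 1" using C(1) by (intro ge_one_powr_ge_zero) auto
      have "2 \<le> ?M" using elim by linarith
      have "real (total_cost cost N (trace N)) \<le> 2 * real (J N) * (C * (real N * ?M)) +
          real (J N) * (real N * ln N * ?E * (?M * ln ?M)) + 1 * (real N ^ 2 * ?M * ln N ^ 2 * ?E) +
          (3 * real (J N) + 3) * (C * (real N * ?M)) + (3 * real (J N) + 6) * (C * ln N ^ 2)"
        using total_cost_le[where cost = cost and N = N and b = "\<lambda>X. B X C N (?m N)", OF elim(1)] elim(3) by (simp add: ops B_def)
      also have "\<dots> \<le> 500 * C * (real N ^ 2 * ln N ^ 4 * ?E)"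
        using elim C(1) E \<open>2 \<le> ?M\<close> by (intro bit_cost_arith) auto
      also have "\<dots> \<le> real N ^ 2 * ln (real N) ^ 4 * 2 powr ((2 * 500 + 1) * C * real (log_star (real N)))"
        using C(1) L by (intro powr_absorb_constant) auto
      finally show ?case .
    qed
    then show ?thesis by blast
  qed
qed

theorem theorem1:
  fixes t :: nat
  assumes "t \<ge> 2"
  shows "\<exists>(c :: prog) (trace :: nat \<Rightarrow> operation list).
    (\<forall>N\<ge>1. \<exists>s. exec N c (init_state N) (trace N) s \<and> (\<forall>n<N. output_coeff s n = int (g_t t n))) \<and>
    (\<forall>N\<ge>1. \<forall>p\<in>set (trace N). arith_within N (nat \<lfloor>log 2 (real (g_t t N))\<rfloor> + 1) p) \<and>
    (\<forall>\<^sub>F N in sequentially. \<forall>p\<in>set (trace N). index_within (nat \<lfloor>log 2 (real N)\<rfloor> + 1) p) \<and>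
    (\<forall>N\<ge>1. num_ops D_op (trace N) = 1) \<and>
    (\<lambda>N. real (num_ops M_op (trace N)) - log (real t) (real N)) \<in> O(\<lambda>_. 1) \<and>
    (\<lambda>N. real (num_ops A_op (trace N)) - 2 * log (real t) (real N)) \<in> O(\<lambda>_. 1) \<and>
    (\<lambda>N. real (num_ops S_op (trace N))) \<in> O(\<lambda>N. ln (real N)) \<and>
    (\<lambda>N. real (num_ops O_op (trace N))) \<in> O(\<lambda>N. ln (real N)) \<and>
    (\<forall>cost. ring_cost_model cost \<longrightarrow>
      (\<exists>C::real. \<forall>\<^sub>F N in sequentially.
        real (total_cost cost N (trace N))
          \<le> real N * ln (real N) ^ 2 * 2 powr (C * real (log_star (real N))))) \<and>
    (\<forall>cost. bit_cost_model cost \<longrightarrow>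
      (\<exists>C::real. \<forall>\<^sub>F N in sequentially.
        real (total_cost cost N (trace N))
          \<le> real N ^ 2 * ln (real N) ^ 4 * 2 powr (C * real (log_star (real N)))))"
proof -
  note t = assms
  \<comment> \<open>The asymptotic claims need \<open>J\<close> and the trace as functions of
    \<open>N\<close>; they are arbitrary at \<open>N = 0\<close>. The program depends on
    \<open>t\<close> only.\<close>
  have "\<forall>N. \<exists>J tr. N \<ge> 1 \<longrightarrow> \<bar>real J - log (real t) (real N)\<bar> \<le> 1 \<and>
    (\<exists>s. exec N (g_t_prog t) (init_state N) tr s \<and> (\<forall>n<N. output_coeff s n = int (g_t t n))) \<and>
    ops_within t N J tr \<and>
    num_ops A_op tr = 2 * J \<and> num_ops M_op tr = J \<and> num_ops D_op tr = 1 \<and>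
    num_ops S_op tr = 3 * J + 3 \<and> num_ops O_op tr = 3 * J + 6"
  proof
    fix N
    show "\<exists>J tr. N \<ge> 1 \<longrightarrow> \<bar>real J - log (real t) (real N)\<bar> \<le> 1 \<and>
      (\<exists>s. exec N (g_t_prog t) (init_state N) tr s \<and> (\<forall>n<N. output_coeff s n = int (g_t t n))) \<and>
      ops_within t N J tr \<and>
      num_ops A_op tr = 2 * J \<and> num_ops M_op tr = J \<and> num_ops D_op tr = 1 \<and>
      num_ops S_op tr = 3 * J + 3 \<and> num_ops O_op tr = 3 * J + 6"
    proof (cases "N \<ge> 1")
      case True
      then obtain J where J: "repunit t J \<le> N" "N < repunit t (Suc J)" "\<bar>real J - log (real t) (real N)\<bar> \<le> 1"
        using repunit_bracket[OF t] by blast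
      then show ?thesis using exec_g_t_prog[OF t True J(1,2)] by blast
    qed blast
  qed
  then obtain J trace where *: "\<And>N. N \<ge> 1 \<Longrightarrow> \<bar>real (J N) - log (real t) (real N)\<bar> \<le> 1 \<and>
    (\<exists>s. exec N (g_t_prog t) (init_state N) (trace N) s \<and> (\<forall>n<N. output_coeff s n = int (g_t t n))) \<and>
    ops_within t N (J N) (trace N) \<and>
    num_ops A_op (trace N) = 2 * J N \<and> num_ops M_op (trace N) = J N \<and> num_ops D_op (trace N) = 1 \<and>
    num_ops S_op (trace N) = 3 * J N + 3 \<and> num_ops O_op (trace N) = 3 * J N + 6"
    by metis
  have J: "\<forall>N\<ge>1. \<bar>real (J N) - log (real t) (real N)\<bar> \<le> 1"
    and within: "\<forall>N\<ge>1. ops_within t N (J N) (trace N)"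
    and ops: "\<forall>N\<ge>1. num_ops A_op (trace N) = 2 * J N"
      "\<forall>N\<ge>1. num_ops M_op (trace N) = J N"
      "\<forall>N\<ge>1. num_ops D_op (trace N) = 1"
      "\<forall>N\<ge>1. num_ops S_op (trace N) = 3 * J N + 3"
      "\<forall>N\<ge>1. num_ops O_op (trace N) = 3 * J N + 6"
    using * by blast+
  have sizes: "\<forall>\<^sub>F N in sequentially. real (J N) + 1 \<le> 4 * ln (real N) \<and> 1 \<le> ln (real N) \<and> N \<ge> t"
    using eventually_sizes[OF t J] by eventually_elim blast
  have index: "\<forall>\<^sub>F N in sequentially. \<forall>p\<in>set (trace N). index_within (nat \<lfloor>log 2 (real N)\<rfloor> + 1) p"
    using sizes
  proof eventually_elim
    case (elim N)
    show ?case
    proof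
      fix p assume "p \<in> set (trace N)"
      then have "admissible N ((J N + 1) * bit_size (int N)) p"
        using within[rule_format, of N] elim t by (auto simp: ops_within_def op_within_def)
      then show "index_within (nat \<lfloor>log 2 (real N)\<rfloor> + 1) p" by (cases p) auto
    qed
  qed
  have M: "(\<lambda>N. real (num_ops M_op (trace N)) - log (real t) (real N)) \<in> O(\<lambda>_. 1)"
    using J by (intro bigoI[of _ 1] eventually_mono[OF eventually_ge_at_top[of 1]]) (simp add: ops)
  have A: "(\<lambda>N. real (num_ops A_op (trace N)) - 2 * log (real t) (real N)) \<in> O(\<lambda>_. 1)"
    using J by (intro bigoI[of _ 2] eventually_mono[OF eventually_ge_at_top[of 1]]) (fastforce simp: ops abs_if)
  \<comment> \<open>\<open>J + 1 \<le> 4 * ln N\<close> gives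
    \<open>3 * J + 3 \<le> 12 * ln N\<close>; the 3 further index operations cost another
    \<open>3 * ln N\<close>.\<close>
  have S: "(\<lambda>N. real (num_ops S_op (trace N))) \<in> O(\<lambda>N. ln (real N))"
    using t by (intro bigoI[of _ 12] eventually_mono[OF sizes]) (auto simp: ops)
  have O: "(\<lambda>N. real (num_ops O_op (trace N))) \<in> O(\<lambda>N. ln (real N))"
    using t by (intro bigoI[of _ 15] eventually_mono[OF sizes]) (auto simp: ops)
  show ?thesis
    using * within index ops(3) M A S O total_ring_cost[OF t J within ops] total_bit_cost[OF t J within ops]
    by (intro exI[of _ "g_t_prog t"] exI[of _ trace] conjI)
       (simp_all add: ops_within_def op_within_def)
qed

end
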